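(* Let $\varphi$ be a smooth real-valued function on a domain $\Omega\subset\mathbb{C}^n$. Then the following are equivalent: (1) $\sqrt{-1}\partial\overline{\partial}\varphi=0$ on $\Omega$ (i.e. $\varphi$ is pluriharmonic); (2) $L_\varphi\equiv1$ on $\Omega_{\widetilde\delta}$; that is, for every $(a,r,s,A)\in\Omega_{\widetilde\delta}$ there exists a unique holomorphic function $f$ on $a+P_{A,r,s}$ with $f(a)=1$ and $\int_{a+P_{A,r,s}}|f|^2e^{-\varphi}\leq|P_{A,r,s}|e^{-\varphi(a)}$.
   Context: $\Delta_r=\{z\in\mathbb{C}\mid|z|<r\}$, $\mathbb{B}^m_s=\{z\in\mathbb{C}^m\mid|z|<s\}$, $\mathbf{U}(n)$ the unitary group, and for $r,s>0$, $A\in\mathbf{U}(n)$ the holomorphic cylinder $P_{A,r,s}=A(\Delta_r\times\mathbb{B}^{n-1}_s)$, with Lebesgue volume $|P_{A,r,s}|$. $\Omega_{\widetilde\delta}=\{(a,r,s,A)\in\Omega\times\mathbb{R}_{>0}\times\mathbb{R}_{>0}\times\mathbf{U}(n)\mid a+P_{A,r,s}\subset\Omega\}$. The $L^2$-extension index is $$L_\varphi(a,r,s,A)=\inf\left\{\frac{\int_{a+P_{A,r,s}}|f|^2e^{-\varphi}}{|P_{A,r,s}|e^{-\varphi(a)}}\ \middle|\ f\text{ holomorphic on }a+P_{A,r,s},\ \int_{a+P_{A,r,s}}|f|^2e^{-\varphi}<\infty,\ f(a)=1\right\}.$$ *)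

theory Defs
  imports "HOL-Analysis.Analysis"
begin

fun Ck_on :: "nat \<Rightarrow> 'a::real_normed_vector set \<Rightarrow> ('a \<Rightarrow> real) \<Rightarrow> bool" where
  "Ck_on 0 S f = continuous_on S f"
| "Ck_on (Suc k) S f = (f differentiable_on S \<and>
       (\<forall>v. Ck_on k S (\<lambda>x. frechet_derivative f (at x) v)))"

definition smooth_on :: "'a::real_normed_vector set \<Rightarrow> ('a \<Rightarrow> real) \<Rightarrow> bool" where
  "smooth_on S f \<longleftrightarrow> (\<forall>k. Ck_on k S f)"

definition dderiv :: "('a::real_normed_vector \<Rightarrow> real) \<Rightarrow> 'a \<Rightarrow> 'a \<Rightarrow> real" where
  "dderiv f x u = frechet_derivative f (at x) u"

definition dderiv2 :: "('a::real_normed_vector \<Rightarrow> real) \<Rightarrow> 'a \<Rightarrow> 'a \<Rightarrow> 'a \<Rightarrow> real" where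
  "dderiv2 f x u v = dderiv (\<lambda>y. dderiv f y v) x u"

text \<open>Complex Hessian entry  d^2 f / (dz_j d conj z_k) at x, where z_j = x_j + i y_j:
  (1/4) [ d_xj d_xk + d_yj d_yk + i (d_xj d_yk - d_yj d_xk) ] f.\<close>
definition ddbar :: "(complex^'n \<Rightarrow> real) \<Rightarrow> complex^'n \<Rightarrow> 'n \<Rightarrow> 'n \<Rightarrow> complex" where
  "ddbar f x j k =
     (complex_of_real (dderiv2 f x (axis j 1) (axis k 1) + dderiv2 f x (axis j \<i>) (axis k \<i>))
      + \<i> * complex_of_real (dderiv2 f x (axis j 1) (axis k \<i>) - dderiv2 f x (axis j \<i>) (axis k 1))) / 4"

definition pluriharmonic_on :: "(complex^'n) set \<Rightarrow> (complex^'n \<Rightarrow> real) \<Rightarrow> bool" where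
  "pluriharmonic_on S f \<longleftrightarrow> (\<forall>x\<in>S. \<forall>j k. ddbar f x j k = 0)"

definition holo_on :: "(complex^'n) set \<Rightarrow> (complex^'n \<Rightarrow> complex) \<Rightarrow> bool" where
  "holo_on S f \<longleftrightarrow> (\<forall>x\<in>S. \<exists>L. (f has_derivative L) (at x within S) \<and>
                       (\<forall>c v. L (c *s v) = c * L v))"

definition unitary :: "complex^'n^'n \<Rightarrow> bool" where
  "unitary A \<longleftrightarrow> (\<chi> i j. cnj (A $ j $ i)) ** A = mat 1"

text \<open>The distinguished first coordinate of C^n (the splitting C^n = C x C^(n-1)).\<close>
definition first_idx :: "'n" where
  "first_idx = (SOME i. True)"

definition cyl0 :: "real \<Rightarrow> real \<Rightarrow> (complex^'n) set" where
  "cyl0 r s = {z. cmod (z $ first_idx) < r \<and>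
                  sqrt (\<Sum>i\<in>UNIV - {first_idx}. (cmod (z $ i))\<^sup>2) < s}"

definition cyl :: "complex^'n^'n \<Rightarrow> real \<Rightarrow> real \<Rightarrow> (complex^'n) set" where
  "cyl A r s = (\<lambda>z. A *v z) ` cyl0 r s"

definition Omega_td :: "(complex^'n) set \<Rightarrow> ((complex^'n) \<times> real \<times> real \<times> (complex^'n^'n)) set" where
  "Omega_td \<Omega> = {(a, r, s, A). a \<in> \<Omega> \<and> r > 0 \<and> s > 0 \<and> unitary A \<and>
                                  (\<lambda>z. a + z) ` cyl A r s \<subseteq> \<Omega>}"

end

theory Submission
  imports Defs "HOL-Complex_Analysis.Cauchy_Integral_Formula"
begin

text \<open>
  Everything rests on the inequality \<open>\<integral>\<^sub>P |g|\<^sup>2 W \<ge> |g(0)|\<^sup>2 \<integral>\<^sub>P W\<close> for \<open>g\<close> holomorphic on a balanced open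
  set \<open>P\<close> and a weight \<open>W\<close> invariant under \<open>z \<mapsto> e\<^sup>i\<^sup>\<theta> z\<close>: averaging over the \<open>N\<close>-th roots of unity does not
  change the left-hand side, and Fatou's lemma applies as \<open>N \<rightarrow> \<infinity>\<close>.

  If \<open>\<phi>\<close> is pluriharmonic, it is the real part of a holomorphic \<open>h\<close> on the (convex) cylinder, and
  \<open>exp ((h - h(a)) / 2)\<close> attains the bound. Dividing any other competitor by it reduces uniqueness to
  \<open>\<phi> = 0\<close>, where the inequality for \<open>(g + 1) / 2\<close> and the parallelogram law force \<open>g = 1\<close>.

  Conversely, near \<open>a\<close> we have \<open>\<phi> = \<phi>(a) + Re q + L + o(|z|\<^sup>2)\<close> with \<open>q\<close> a holomorphic polynomial and \<open>L\<close>
  the Levi form. Take a cylinder that is thin around a direction \<open>\<xi>\<close>. If \<open>L(\<xi>) < 0\<close>, the inequality with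
  weight \<open>exp (-L)\<close> excludes every competitor. If \<open>L(\<xi>) > 0\<close>, then \<open>exp (q / 2)\<close> satisfies the bound
  strictly, hence so do its small perturbations, against uniqueness.
\<close>

section \<open>Rotation invariance and the mean value inequality\<close>

text \<open>On a general cylinder the weight averages the Levi form over all directions, and
  eigenvalues of opposite sign could cancel. Radii \<open>r\<close> and \<open>\<delta> * r\<close>
  with a small fixed \<open>\<delta>\<close> isolate the axis: the cross terms and the transverse
  part of the Levi form are then at most a small multiple of \<open>r\<^sup>2\<close>, like the
  Taylor remainder, whereas the axis term is itself of order \<open>r\<^sup>2\<close> on the outer
  half \<open>cmod (cyl_fst A z) \<ge> r / 2\<close>, which fills at least half of the volume. With
  the total error held to 1/16 of the axis coefficient, an outer effect of at least 3/16 beats an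
  inner one of at most 1/16 in the other direction. The average runs over finitely many rotations
  because each of them preserves Lebesgue measure on its own: no circle integral has to be exchanged
  with the volume integral, and an infinite right-hand side does no harm.\<close>

lemma distr_lborel_orthogonal:
  fixes T :: "'a::euclidean_space \<Rightarrow> 'a"
  assumes card: "CARD('m::{finite,wellorder}) = DIM('a)" and T: "orthogonal_transformation T"
  shows "distr lborel borel T = lborel"
proof -
  \<comment> \<open>Invariance of measure under orthogonal images is at hand on
    \<open>real^'m\<close> with well-ordered \<open>'m\<close>; an enumeration of the orthonormal
    \<open>Basis\<close> carries it over to \<open>'a\<close>.\<close>
  obtain \<beta> where \<beta>: "bij_betw \<beta> (UNIV::'m set) (Basis::'a set)"
    using card by (metis finite_Basis finite finite_same_card_bij)
  have \<beta>B: "\<beta> i \<in> Basis" for i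
    using \<beta> by (auto simp: bij_betw_def)
  have inner_\<beta>: "\<beta> i \<bullet> \<beta> j = (if i = j then 1 else 0)" for i j
    using inner_Basis[OF \<beta>B[of i] \<beta>B[of j]] \<beta> by (auto simp: bij_betw_def inj_on_def)
  define \<Phi> where "\<Phi> = (\<lambda>x::real^'m::_. \<Sum>i\<in>UNIV. (x $ i) *\<^sub>R \<beta> i)"
  define \<Psi> where "\<Psi> = (\<lambda>y::'a. (\<chi> i. y \<bullet> \<beta> i) :: real^'m::_)"
  have \<Phi>_inner: "\<Phi> x \<bullet> \<beta> i = x $ i" for x i
    by (simp add: \<Phi>_def inner_sum_left inner_\<beta> if_distrib cong: if_cong)
  have \<Psi>\<Phi>: "\<Psi> (\<Phi> x) = x" for x
    by (simp add: \<Psi>_def \<Phi>_inner vec_eq_iff)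
  have \<Phi>\<Psi>: "\<Phi> (\<Psi> y) = y" for y
  proof -
    have "\<Phi> (\<Psi> y) = (\<Sum>b\<in>Basis. (y \<bullet> b) *\<^sub>R b)"
      unfolding \<Phi>_def \<Psi>_def using sum.reindex_bij_betw[OF \<beta>, of "\<lambda>b. (y \<bullet> b) *\<^sub>R b"] by simp
    then show ?thesis by (simp add: euclidean_representation)
  qed
  have lin\<Phi>: "linear \<Phi>"
    unfolding \<Phi>_def by (rule linearI) (simp_all add: algebra_simps sum.distrib scaleR_sum_right)
  have lin\<Psi>: "linear \<Psi>"
    unfolding \<Psi>_def by (rule linearI) (simp_all add: inner_add_left vec_eq_iff)
  have norm\<Phi>: "norm (\<Phi> x) = norm x" for x
  proof -
    have "norm (\<Phi> x) ^ 2 = (\<Sum>i\<in>UNIV. x $ i * (\<beta> i \<bullet> \<Phi> x))"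
      unfolding power2_norm_eq_inner by (subst \<Phi>_def) (simp add: inner_sum_left)
    also have "\<dots> = norm x ^ 2"
      unfolding power2_norm_eq_inner by (simp add: inner_commute \<Phi>_inner inner_vec_def)
    finally show ?thesis by simp
  qed
  have norm\<Psi>: "norm (\<Psi> y) = norm y" for y
    using norm\<Phi>[of "\<Psi> y"] by (simp add: \<Phi>\<Psi>)
  have [measurable]: "\<Phi> \<in> borel_measurable borel" "T \<in> borel_measurable borel"
    using lin\<Phi> T by (auto intro!: borel_measurable_continuous_onI linear_continuous_on
      simp: linear_linear orthogonal_transformation_linear)
  have \<Phi>box: "\<Phi> -` box l u = box (\<Psi> l) (\<Psi> u)" for l u
  proof -
    have "x \<in> \<Phi> -` box l u \<longleftrightarrow> (\<forall>i. l \<bullet> \<beta> i < x $ i \<and> x $ i < u \<bullet> \<beta> i)" for x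
      using \<beta> unfolding vimage_eq mem_box by (metis \<Phi>_inner bij_betw_def rangeE rangeI \<beta>B)
    then show ?thesis by (auto simp: mem_box_cart \<Psi>_def)
  qed
  have d\<Phi>: "lborel = distr lborel borel \<Phi>"
  proof (rule lborel_eqI)
    fix l u :: 'a assume le: "\<And>b. b \<in> Basis \<Longrightarrow> l \<bullet> b \<le> u \<bullet> b"
    have "emeasure (distr lborel borel \<Phi>) (box l u) = emeasure lborel (box (\<Psi> l) (\<Psi> u))"
      by (simp add: emeasure_distr \<Phi>box)
    also have "\<dots> = ennreal (\<Prod>b\<in>Basis. (\<Psi> u - \<Psi> l) \<bullet> b)"
      by (subst emeasure_lborel_box)
         (use le \<beta>B in \<open>auto simp: \<Psi>_def Basis_vec_def inner_axis\<close>)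
    also have "(\<Prod>b\<in>Basis. (\<Psi> u - \<Psi> l) \<bullet> b) = (\<Prod>i\<in>UNIV. (\<Psi> u - \<Psi> l) \<bullet> axis i 1)"
      by (subst prod.reindex_bij_betw[of "\<lambda>i::'m. axis i (1::real)" UNIV Basis, symmetric])
         (auto simp: bij_betw_def inj_on_def axis_eq_axis Basis_vec_def)
    also have "\<dots> = (\<Prod>i\<in>UNIV. (u - l) \<bullet> \<beta> i)"
      by (simp add: inner_axis \<Psi>_def inner_diff_left)
    also have "\<dots> = (\<Prod>b\<in>Basis. (u - l) \<bullet> b)"
      using \<beta> by (rule prod.reindex_bij_betw)
    finally show "emeasure (distr lborel borel \<Phi>) (box l u) = ennreal (\<Prod>b\<in>Basis. (u - l) \<bullet> b)" .
  qed simp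
  have T': "linear (inv T)" "norm (inv T x) = norm x" "T (inv T x) = x" "inv T (T x) = x" for x
  proof -
    have "orthogonal_transformation (inv T)" using T by (rule orthogonal_transformation_inv)
    then show "linear (inv T)" "norm (inv T x) = norm x" 
      by (auto simp: orthogonal_transformation)
    show "T (inv T x) = x" "inv T (T x) = x"
      using orthogonal_transformation_bij[OF T] by (auto simp: bij_def surj_f_inv_f)
  qed
  \<comment> \<open>Invariance concerns images, whereas \<open>distr\<close> asks for preimages: the
    preimage of a box under \<open>T \<circ> \<Phi>\<close> is the image, under this orthogonal map,
    of its preimage under \<open>\<Phi>\<close>.\<close>
  define S where "S = \<Psi> \<circ> inv T \<circ> \<Phi>"
  have S: "orthogonal_transformation S"
    unfolding orthogonal_transformation S_def
    by (auto intro!: linear_compose lin\<Phi> lin\<Psi> T' simp: norm\<Phi> norm\<Psi> T')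
  show ?thesis
  proof (rule lborel_eqI[symmetric])
    fix l u :: 'a assume le: "\<And>b. b \<in> Basis \<Longrightarrow> l \<bullet> b \<le> u \<bullet> b"
    let ?B = "\<Phi> -` box l u"
    have B: "?B \<in> lmeasurable" by (simp add: \<Phi>box)
    have eq: "\<Phi> -` T -` box l u = S ` ?B"
    proof safe
      fix x assume "T (\<Phi> x) \<in> box l u"
      then show "x \<in> S ` ?B"
        by (intro image_eqI[of _ _ "\<Psi> (T (\<Phi> x))"]) (auto simp: S_def \<Phi>\<Psi> \<Psi>\<Phi> T')
    qed (auto simp: S_def \<Phi>\<Psi> T')
    have [measurable]: "T -` box l u \<in> sets borel" 
      using measurable_sets[of T borel borel "box l u"] by simp
    have Tm: "\<Phi> -` T -` box l u \<in> sets borel" 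
      using measurable_sets[of \<Phi> borel borel "T -` box l u"] by simp
    have "emeasure (distr lborel borel T) (box l u) = emeasure lborel (T -` box l u)"
      by (simp add: emeasure_distr)
    also have "\<dots> = emeasure lborel (\<Phi> -` T -` box l u)"
      by (subst d\<Phi>) (simp add: emeasure_distr)
    also have "\<dots> = emeasure lebesgue (S ` ?B)"
      using Tm by (simp add: eq)
    also have "\<dots> = emeasure lebesgue ?B"
      using measurable_orthogonal_image[OF S B] measure_orthogonal_image[OF S B] B
      by (simp add: emeasure_eq_measure2)
    also have "\<dots> = emeasure (distr lborel borel \<Phi>) (box l u)"
      by (simp add: emeasure_distr \<Phi>box)
    also have "\<dots> = ennreal (\<Prod>b\<in>Basis. (u - l) \<bullet> b)"
      by (subst d\<Phi>[symmetric]) (simp add: emeasure_lborel_box le)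
    finally show "emeasure (distr lborel borel T) (box l u) = ennreal (\<Prod>b\<in>Basis. (u - l) \<bullet> b)" .
  qed simp
qed

section \<open>Complex rotations and averages over roots of unity\<close>

lemma norm_vector_smult: "norm (c *s (z::complex^'n)) = cmod c * norm z"
  by (simp add: norm_vec_def L2_set_def norm_mult power_mult_distrib real_sqrt_mult
      flip: sum_distrib_left)

lemma bounded_linear_vector_smult: "bounded_linear (\<lambda>z::complex^'n. c *s z)"
  by (rule bounded_linear_intro[of _ "cmod c"])
     (auto simp: norm_vector_smult vec_eq_iff algebra_simps)

lemma bounded_linear_vector_smult_left: "bounded_linear (\<lambda>c::complex. c *s (z::complex^'n))"
  by (rule bounded_linear_intro[of _ "norm z"])
     (auto simp: norm_vector_smult vec_eq_iff algebra_simps)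

lemma nn_integral_lborel_rotation:
  fixes f :: "complex^'n \<Rightarrow> ennreal"
  assumes [measurable]: "f \<in> borel_measurable borel" and c: "cmod c = 1"
  shows "(\<integral>\<^sup>+ z. f (c *s z) \<partial>lborel) = (\<integral>\<^sup>+ z. f z \<partial>lborel)"
proof -
  have [measurable]: "(\<lambda>z::complex^'n. c *s z) \<in> borel_measurable borel"
    by (intro borel_measurable_continuous_onI linear_continuous_on bounded_linear_vector_smult)
  \<comment> \<open>\<open>'n bit0\<close> has twice as many elements as \<open>'n\<close>, which is
    the real dimension of \<open>complex^'n\<close>.\<close>
  have "distr lborel borel (\<lambda>z::complex^'n. c *s z) = lborel"
    by (rule distr_lborel_orthogonal[where 'm="'n bit0"])
       (auto simp: orthogonal_transformation norm_vector_smult c bounded_linear.linear[OF bounded_linear_vector_smult])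
  then have "(\<integral>\<^sup>+ z. f z \<partial>lborel) = (\<integral>\<^sup>+ z. f z \<partial>(distr lborel borel (\<lambda>z::complex^'n. c *s z)))"
    by simp
  then show ?thesis by (simp add: nn_integral_distr)
qed

text \<open>The average of \<open>w ^ n\<close> over the roots of unity of order
  \<open>Suc N\<close> is 0 for \<open>0 < n < Suc N\<close>, so the average of \<open>h\<close>
  differs from its constant term only by a tail of the Taylor series. A radius beyond 1 makes that
  series absolutely convergent on the unit circle.\<close>

lemma roots_of_unity_mean_tendsto:
  assumes hol: "h holomorphic_on ball 0 \<rho>" and "1 < \<rho>"
  shows "(\<lambda>N. (\<Sum>k<Suc N. h (cis (2 * pi * real k / real (Suc N)))) / of_nat (Suc N)) \<longlonglongrightarrow> h 0"
proof -
  define c where "c n = (deriv ^^ n) h 0 / fact n" for n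
  have sums: "(\<lambda>n. c n * w ^ n) sums h w" if "cmod w < \<rho>" for w
    using holomorphic_power_series[OF hol, of w] that by (simp add: c_def)
  have sm: "summable (\<lambda>n. norm (c n))"
  proof -
    \<comment> \<open>Convergence at a point strictly between 1 and \<open>\<rho>\<close> yields
      absolute convergence at 1.\<close>
    define x where "x = complex_of_real ((1 + \<rho>) / 2)"
    have x: "cmod x < \<rho>" "cmod 1 < cmod x" using \<open>1 < \<rho>\<close> unfolding x_def norm_of_real by auto
    show ?thesis using powser_insidea[OF sums_summable[OF sums[OF x(1)]] x(2)] by simp
  qed
  have h0: "h 0 = c 0" by (simp add: c_def)
  have bound: "norm ((\<Sum>k<Suc N. h (cis (2 * pi * real k / real (Suc N)))) / of_nat (Suc N) - h 0)
      \<le> (\<Sum>n. norm (c (n + Suc N)))" for N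
  proof -
    let ?M = "Suc N"
    let ?w = "\<lambda>k. cis (2 * pi * real k / real ?M)"
    define a where "a n = (\<Sum>k<?M. ?w k ^ n) / of_nat ?M" for n
    have "(\<lambda>n. \<Sum>k<?M. c n * ?w k ^ n) sums (\<Sum>k<?M. h (?w k))"
      by (intro sums_sum sums) (use \<open>1 < \<rho>\<close> in auto)
    then have "(\<lambda>n. (\<Sum>k<?M. c n * ?w k ^ n) / of_nat ?M) sums ((\<Sum>k<?M. h (?w k)) / of_nat ?M)"
      by (rule sums_divide)
    then have S: "(\<lambda>n. c n * a n) sums ((\<Sum>k<?M. h (?w k)) / of_nat ?M)"
      by (simp add: a_def sum_distrib_left del: sum.lessThan_Suc)
    have a0: "a 0 = 1" by (simp add: a_def del: of_nat_Suc)
    have an: "a n = 0" if "0 < n" "n < ?M" for n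
    proof -
      have p: "?w k ^ n = ?w n ^ k" for k
        unfolding Complex.DeMoivre by (rule arg_cong[where f = cis]) (simp add: field_simps)
      have ne: "?w n \<noteq> 1"
      proof
        assume "?w n = 1"
        then have "cos (2 * pi * real n / real ?M) = 1" by (simp add: complex_eq_iff)
        then obtain j :: int where "2 * pi * real n / real ?M = of_int j * 2 * pi"
          using cos_one_2pi_int by auto
        then have "2 * pi * real n = 2 * pi * (of_int j * real ?M)" 
          by (simp add: divide_eq_eq mult_ac del: of_nat_Suc)
        then have "real n = of_int j * real ?M" by (simp del: of_nat_Suc)
        then have "of_int (int n) = (of_int (j * int ?M) :: real)" by simp
        then have "int n = j * int ?M" unfolding of_int_eq_iff .
        then have "int ?M dvd int n" by simp
        then have "?M dvd n" by presburger
        with that show False by (auto dest: dvd_imp_le)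
      qed
      have "?w n ^ ?M = cis (2 * pi * real n)" 
        unfolding Complex.DeMoivre by (simp del: of_nat_Suc)
      also have "\<dots> = 1" by (metis cis_multiple_2pi Ints_of_nat mult.commute mult.assoc)
      finally have 1: "?w n ^ ?M = 1" .
      have "(\<Sum>k<?M. ?w n ^ k) = 0"
        using geometric_sum[OF ne, of ?M] 1 by simp
      then show ?thesis by (simp add: a_def p del: sum.lessThan_Suc of_nat_Suc)
    qed
    \<comment> \<open>Beyond the first block the means need not vanish (they are 1 at multiples of
      \<open>Suc N\<close>), so they are merely bounded.\<close>
    have a_le: "norm (a n) \<le> 1" for n
    proof -
      have "norm (\<Sum>k<?M. ?w k ^ n) \<le> (\<Sum>k<?M. 1)"
        by (rule order_trans[OF norm_sum]) (simp add: norm_power)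
      then show ?thesis by (simp add: a_def norm_divide divide_le_eq_1 del: sum.lessThan_Suc of_nat_Suc)
    qed
    have "(\<lambda>n. c (n + ?M) * a (n + ?M)) sums
        ((\<Sum>k<?M. h (?w k)) / of_nat ?M - (\<Sum>n<?M. c n * a n))"
      using S by (subst sums_iff_shift) simp
    also have "(\<Sum>n<?M. c n * a n) = (\<Sum>n<?M. if n = 0 then c 0 else 0)"
      by (intro sum.cong) (auto simp: a0 an)
    also have "\<dots> = h 0" by (simp add: h0 del: sum.lessThan_Suc)
    finally have "(\<Sum>k<?M. h (?w k)) / of_nat ?M - h 0 = (\<Sum>n. c (n + ?M) * a (n + ?M))"
      by (rule sums_unique)
    also have "norm \<dots> \<le> (\<Sum>n. norm (c (n + ?M)))"
    proof (rule norm_suminf_le)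
      show "norm (c (n + ?M) * a (n + ?M)) \<le> norm (c (n + ?M))" for n
        using mult_left_mono[OF a_le, of "norm (c (n + ?M))"] by (simp add: norm_mult)
      show "summable (\<lambda>n. norm (c (n + ?M)))"
        using sm by (subst summable_iff_shift)
    qed
    finally show ?thesis .
  qed
  have "(\<lambda>N. \<Sum>n. norm (c (n + N))) \<longlonglongrightarrow> 0"
    using suminf_exist_split2[OF sm] .
  then have "(\<lambda>N. \<Sum>n. norm (c (n + Suc N))) \<longlonglongrightarrow> 0"
    by (rule LIMSEQ_Suc)
  then show ?thesis
    unfolding LIM_zero_iff[symmetric, of _ "h 0"]
    by (rule Lim_null_comparison[rotated]) (use bound in auto)
qed

lemma holo_on_imp_continuous_on: "holo_on S f \<Longrightarrow> continuous_on S f"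
  unfolding holo_on_def continuous_on_eq_continuous_within
  by (blast intro: has_derivative_continuous)

lemma holo_on_line:
  assumes hol: "holo_on S f" and S: "open S"
  shows "(\<lambda>w. f (w *s z)) holomorphic_on {w. w *s z \<in> S}"
  unfolding holomorphic_on_def
proof
  fix w assume "w \<in> {w. w *s z \<in> S}"
  then have w: "w *s z \<in> S" by simp
  then obtain L where L: "(f has_derivative L) (at (w *s z))" and lin: "\<And>c v. L (c *s v) = c * L v"
    using hol[unfolded holo_on_def, rule_format, OF w] at_within_open[OF w S] by metis
  have "((\<lambda>w. f (w *s z)) has_derivative (\<lambda>h. L (h *s z))) (at w)"
    using has_derivative_compose[OF bounded_linear.has_derivative[OF bounded_linear_vector_smult_left has_derivative_ident] L] .
  then have "((\<lambda>w. f (w *s z)) has_field_derivative L z) (at w)"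
    unfolding has_field_derivative_def lin mult.commute[of _ "L z"] .
  then show "(\<lambda>w. f (w *s z)) field_differentiable at w within {w. w *s z \<in> S}"
    using field_differentiable_at_within field_differentiable_def by blast
qed

lemma borel_measurable_indicator_ennreal:
  fixes f :: "'a::topological_space \<Rightarrow> real"
  assumes "S \<in> sets borel" "continuous_on S f"
  shows "(\<lambda>x. ennreal (f x) * indicator S x) \<in> borel_measurable borel"
proof -
  have "(\<lambda>x. indicator S x *\<^sub>R f x) \<in> borel_measurable borel"
    using assms by (rule borel_measurable_continuous_on_indicator)
  then have "(\<lambda>x. ennreal (indicator S x *\<^sub>R f x)) \<in> borel_measurable borel"
    by measurable
  also have "(\<lambda>x. ennreal (indicator S x *\<^sub>R f x)) = (\<lambda>x. ennreal (f x) * indicator S x)"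
    by (auto simp: indicator_def)
  finally show ?thesis .
qed

lemma holo_square_mean_ge:
  fixes P :: "(complex^'n) set"
  assumes P: "open P" and bal: "\<And>c z. cmod c \<le> 1 \<Longrightarrow> z \<in> P \<Longrightarrow> c *s z \<in> P"
    and hol: "holo_on P g"
    and W: "continuous_on P W" "\<And>z. 0 \<le> W z"
    and inv: "\<And>c z. cmod c = 1 \<Longrightarrow> W (c *s z) = W z"
  shows "(\<integral>\<^sup>+ z. ennreal ((cmod (g 0))\<^sup>2 * W z) * indicator P z \<partial>lborel)
       \<le> (\<integral>\<^sup>+ z. ennreal ((cmod (g z))\<^sup>2 * W z) * indicator P z \<partial>lborel)"
proof -
  define G where "G z = ennreal ((cmod (g z))\<^sup>2 * W z) * indicator P z" for z
  define \<omega> where "\<omega> N k = cis (2 * pi * real k / real (Suc N))" for N k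
  have \<omega>: "cmod (\<omega> N k) = 1" for N k by (simp add: \<omega>_def)
  have Gm [measurable]: "G \<in> borel_measurable borel"
    unfolding G_def
    by (intro borel_measurable_indicator_ennreal continuous_intros holo_on_imp_continuous_on[OF hol] W)
       (use P in auto)
  have rot: "c *s z \<in> P \<longleftrightarrow> z \<in> P" if "cmod c = 1" for c z
  proof
    assume "c *s z \<in> P"
    then have "inverse c *s (c *s z) \<in> P" using that by (rule_tac bal) (auto simp: norm_inverse)
    moreover have "inverse c *s (c *s z) = z"
      using that by (cases "c = 0") (simp_all add: vec_eq_iff flip: mult.assoc)
    ultimately show "z \<in> P" by simp
  qed (use bal that in auto)
  have Grot: "G (c *s z) = ennreal ((cmod (g (c *s z)))\<^sup>2 * W z) * indicator P z" if "cmod c = 1" for c z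
    using that by (simp add: G_def inv rot indicator_def)
  have [measurable]: "(\<lambda>z::complex^'n. c *s z) \<in> borel_measurable borel" for c
    by (intro borel_measurable_continuous_onI linear_continuous_on bounded_linear_vector_smult)
  define u where "u N z = ennreal (1 / real (Suc N)) * (\<Sum>k<Suc N. G (\<omega> N k *s z))" for N z
  have um [measurable]: "u N \<in> borel_measurable lborel" for N
    unfolding u_def by measurable
  have iu: "integral\<^sup>N lborel (u N) = integral\<^sup>N lborel G" for N
  proof -
    have "integral\<^sup>N lborel (u N) = ennreal (1 / real (Suc N)) * (\<Sum>k<Suc N. \<integral>\<^sup>+z. G (\<omega> N k *s z) \<partial>lborel)"
      unfolding u_def by (subst nn_integral_cmult) (auto simp: nn_integral_sum simp del: sum.lessThan_Suc)
    also have "\<dots> = ennreal (1 / real (Suc N)) * (of_nat (Suc N) * integral\<^sup>N lborel G)"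
      by (simp add: nn_integral_lborel_rotation \<omega> del: sum.lessThan_Suc of_nat_Suc)
    also have "\<dots> = ennreal (1 / real (Suc N) * real (Suc N)) * integral\<^sup>N lborel G"
      by (subst ennreal_mult) (auto simp: mult.assoc ennreal_of_nat_eq_real_of_nat)
    finally show ?thesis by simp
  qed
  \<comment> \<open>On the disc through \<open>z\<close> the mean of the rotated values tends to
    \<open>g 0\<close>, and by Cauchy-Schwarz the squared modulus of a mean is at most the mean of
    the squares. \<open>W\<close> is constant along the rotations and factors out.\<close>
  have key: "ennreal ((cmod (g 0))\<^sup>2 * W z) * indicator P z \<le> liminf (\<lambda>N. u N z)" for z
  proof (cases "z \<in> P")
    case True
    let ?h = "\<lambda>w. g (w *s z)"
    let ?m = "\<lambda>N. (\<Sum>k<Suc N. ?h (\<omega> N k)) / of_nat (Suc N)"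
    have "open ((\<lambda>w. w *s z) -` P)"
      by (intro open_vimage P linear_continuous_on bounded_linear_vector_smult_left)
    moreover have "cball 0 1 \<subseteq> (\<lambda>w. w *s z) -` P" using bal True by auto
    ultimately obtain e where e: "e > 0" "(\<Union>x\<in>cball 0 1. ball x e) \<subseteq> (\<lambda>w. w *s z) -` P"
      using compact_subset_open_imp_ball_epsilon_subset[of "cball (0::complex) 1"] by (metis compact_cball)
    \<comment> \<open>The means converge only if the disc extends beyond radius 1. Compactness of
      the closed disc provides the room; a point outside it is compared with its radial projection
      to the unit circle.\<close>
    have "ball 0 (1 + e) \<subseteq> (\<lambda>w. w *s z) -` P"
    proof
      fix w :: complex assume w: "w \<in> ball 0 (1 + e)"
      show "w \<in> (\<lambda>w. w *s z) -` P"
      proof (cases "cmod w \<le> 1")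
        case True then show ?thesis using bal \<open>z \<in> P\<close> by auto
      next
        case False
        have "w - w /\<^sub>R cmod w = (cmod w - 1) *\<^sub>R (w /\<^sub>R cmod w)"
          using False by (cases "w = 0") (simp_all add: algebra_simps)
        then have "dist (w /\<^sub>R cmod w) w = cmod w - 1"
          using False by (cases "w = 0") (simp_all add: dist_norm norm_minus_commute)
        then have "w \<in> ball (w /\<^sub>R cmod w) e" using w by simp
        moreover have "w /\<^sub>R cmod w \<in> cball 0 1" by (cases "w = 0") simp_all
        ultimately show ?thesis using e(2) by blast
      qed
    qed
    then have "?h holomorphic_on ball 0 (1 + e)"
      using holo_on_line[OF hol P, of z] by (rule_tac holomorphic_on_subset) (auto simp: vimage_def)
    from roots_of_unity_mean_tendsto[OF this] e have lim: "?m \<longlonglongrightarrow> g 0"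
      by (simp add: \<omega>_def)
    have le: "ennreal ((cmod (?m N))\<^sup>2 * W z) \<le> u N z" for N
    proof -
      have "(cmod (\<Sum>k<Suc N. ?h (\<omega> N k)))\<^sup>2 \<le> (\<Sum>k<Suc N. cmod (?h (\<omega> N k)))\<^sup>2"
        by (intro power_mono norm_sum) auto
      also have "\<dots> \<le> real (Suc N) * (\<Sum>k<Suc N. (cmod (?h (\<omega> N k)))\<^sup>2)"
        using Cauchy_Schwarz_ineq_sum[of "\<lambda>_. 1" "\<lambda>k. cmod (?h (\<omega> N k))" "{..<Suc N}"] by simp
      finally have "(cmod (?m N))\<^sup>2 \<le> 1 / real (Suc N) * (\<Sum>k<Suc N. (cmod (?h (\<omega> N k)))\<^sup>2)"
        unfolding norm_divide power_divide norm_of_nat 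
        by (simp add: field_simps power2_eq_square del: sum.lessThan_Suc of_nat_Suc)
      then have "(cmod (?m N))\<^sup>2 * W z \<le> (1 / real (Suc N) * (\<Sum>k<Suc N. (cmod (?h (\<omega> N k)))\<^sup>2)) * W z"
        by (intro mult_right_mono W)
      also have "\<dots> = 1 / real (Suc N) * (\<Sum>k<Suc N. (cmod (?h (\<omega> N k)))\<^sup>2 * W z)"
        by (simp add: sum_distrib_right mult.assoc del: sum.lessThan_Suc)
      finally have "ennreal ((cmod (?m N))\<^sup>2 * W z) \<le> ennreal (1 / real (Suc N)) * ennreal (\<Sum>k<Suc N. (cmod (?h (\<omega> N k)))\<^sup>2 * W z)"
        using W by (subst ennreal_mult[symmetric]) (auto intro!: ennreal_leI sum_nonneg simp del: sum.lessThan_Suc)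
      also have "\<dots> = u N z"
        using True W by (simp add: u_def Grot \<omega> del: sum.lessThan_Suc)
      finally show ?thesis .
    qed
    have "(\<lambda>N. ennreal ((cmod (?m N))\<^sup>2 * W z)) \<longlonglongrightarrow> ennreal ((cmod (g 0))\<^sup>2 * W z)"
      by (intro tendsto_intros lim)
    then have "ennreal ((cmod (g 0))\<^sup>2 * W z) = liminf (\<lambda>N. ennreal ((cmod (?m N))\<^sup>2 * W z))"
      by (simp add: lim_imp_Liminf)
    also have "\<dots> \<le> liminf (\<lambda>N. u N z)"
      by (intro Liminf_mono always_eventually allI le)
    finally show ?thesis using True by simp
  qed simp
  have "(\<integral>\<^sup>+ z. ennreal ((cmod (g 0))\<^sup>2 * W z) * indicator P z \<partial>lborel)
      \<le> (\<integral>\<^sup>+ z. liminf (\<lambda>N. u N z) \<partial>lborel)"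
    by (intro nn_integral_mono key)
  also have "\<dots> \<le> liminf (\<lambda>N. integral\<^sup>N lborel (u N))"
    by (rule nn_integral_liminf) measurable
  also have "\<dots> = integral\<^sup>N lborel G" by (simp add: iu Liminf_const)
  finally show ?thesis unfolding G_def[abs_def] .
qed

section \<open>Second derivatives\<close>

lemma smooth_on_dderiv:
  assumes "open S" "smooth_on S f" "x \<in> S"
  shows "(f has_derivative dderiv f x) (at x)"
proof -
  have "Ck_on (Suc 0) S f" using assms(2) unfolding smooth_on_def by blast
  then have "f differentiable_on S" unfolding Ck_on.simps by blast
  then have "f differentiable (at x)"
    using assms(1,3) by (simp add: differentiable_on_eq_differentiable_at)
  moreover have "dderiv f x = frechet_derivative f (at x)" by (simp add: dderiv_def fun_eq_iff)
  ultimately show ?thesis by (simp add: frechet_derivative_works)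
qed

lemma smooth_on_dderiv2:
  assumes "open S" "smooth_on S f" "x \<in> S"
  shows "((\<lambda>y. dderiv f y v) has_derivative (\<lambda>u. dderiv2 f x u v)) (at x)"
proof -
  have "Ck_on (Suc (Suc 0)) S f" using assms(2) unfolding smooth_on_def by blast
  then have "(\<lambda>y. dderiv f y v) differentiable_on S" unfolding Ck_on.simps dderiv_def by blast
  then have "(\<lambda>y. dderiv f y v) differentiable (at x)"
    using assms(1,3) by (simp add: differentiable_on_eq_differentiable_at)
  moreover have "(\<lambda>u. dderiv2 f x u v) = frechet_derivative (\<lambda>y. dderiv f y v) (at x)"
    unfolding dderiv2_def by (simp add: dderiv_def fun_eq_iff)
  ultimately show ?thesis by (simp add: frechet_derivative_works)
qed

lemma smooth_on_continuous_dderiv2: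
  assumes "smooth_on S f"
  shows "continuous_on S (\<lambda>x. dderiv2 f x u v)"
proof -
  have "Ck_on (Suc (Suc 0)) S f" using assms unfolding smooth_on_def by blast
  then show ?thesis unfolding Ck_on.simps dderiv2_def dderiv_def by blast
qed

lemma smooth_on_imp_continuous_on:
  assumes "smooth_on S f"
  shows "continuous_on S f"
proof -
  have "Ck_on 0 S f" using assms unfolding smooth_on_def by blast
  then show ?thesis by simp
qed

section \<open>Bilinearity, symmetry and Taylor expansion for second derivatives\<close>

lemma bilinear_dderiv2:
  assumes "open S" "smooth_on S f" "x \<in> S"
  shows "bilinear (dderiv2 f x)"
proof -
  note lin = linear_add[OF has_derivative_linear[OF smooth_on_dderiv[OF assms(1,2)]]]
    linear_scale[OF has_derivative_linear[OF smooth_on_dderiv[OF assms(1,2)]]]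
  note d2 = smooth_on_dderiv2[OF assms]
  have "dderiv2 f x u (v + w) = dderiv2 f x u v + dderiv2 f x u w" for u v w
  proof -
    \<comment> \<open>Additivity in the inner direction holds at every point of \<open>S\<close>,
      hence near \<open>x\<close>, and so survives differentiation at \<open>x\<close>.\<close>
    have "((\<lambda>y. dderiv f y (v + w)) has_derivative (\<lambda>u. dderiv2 f x u v + dderiv2 f x u w)) (at x)"
      by (rule has_derivative_transform_within_open[OF has_derivative_add[OF d2 d2] assms(1,3)])
         (simp add: lin)
    from has_derivative_unique[OF this d2] show ?thesis by (simp add: fun_eq_iff)
  qed
  moreover have "dderiv2 f x u (c *\<^sub>R v) = c *\<^sub>R dderiv2 f x u v" for u v c
  proof -
    have "((\<lambda>y. dderiv f y (c *\<^sub>R v)) has_derivative (\<lambda>u. c *\<^sub>R dderiv2 f x u v)) (at x)"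
      by (rule has_derivative_transform_within_open[OF has_derivative_scaleR_right[OF d2] assms(1,3)])
         (simp add: lin)
    from has_derivative_unique[OF this d2] show ?thesis by (simp add: fun_eq_iff)
  qed
  ultimately show ?thesis
    unfolding bilinear_def using has_derivative_linear[OF d2] by (auto intro!: linearI)
qed

text \<open>The mean value theorem is used twice: along \<open>u\<close> for the increment of
  \<open>f\<close> in direction \<open>v\<close>, then along \<open>v\<close> for the derivative in
  direction \<open>u\<close>. The last differentiation comes first among the arguments of
  \<open>dderiv2\<close>, hence the order \<open>v u\<close>.\<close>

lemma second_difference:
  fixes x u v :: "'a::real_normed_vector"
  assumes S: "open S" "smooth_on S f" and "0 < s"
    and sub: "\<And>\<alpha> \<beta>. 0 \<le> \<alpha> \<Longrightarrow> \<alpha> \<le> s \<Longrightarrow> 0 \<le> \<beta> \<Longrightarrow> \<beta> \<le> s \<Longrightarrow> x + \<alpha> *\<^sub>R u + \<beta> *\<^sub>R v \<in> S"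
  obtains \<alpha> \<beta> where "0 < \<alpha>" "\<alpha> < s" "0 < \<beta>" "\<beta> < s"
    "f (x + s *\<^sub>R u + s *\<^sub>R v) - f (x + s *\<^sub>R u) - f (x + s *\<^sub>R v) + f x
      = s\<^sup>2 * dderiv2 f (x + \<alpha> *\<^sub>R u + \<beta> *\<^sub>R v) v u"
proof -
  have D1: "((\<lambda>t. f (x + t *\<^sub>R u + \<beta> *\<^sub>R v)) has_real_derivative dderiv f (x + t *\<^sub>R u + \<beta> *\<^sub>R v) u) (at t)"
    if "0 \<le> t" "t \<le> s" "0 \<le> \<beta>" "\<beta> \<le> s" for t \<beta>
  proof -
    note d = smooth_on_dderiv[OF S sub[OF that]]
    have "((\<lambda>t. x + t *\<^sub>R u + \<beta> *\<^sub>R v) has_derivative (\<lambda>h. h *\<^sub>R u)) (at t)"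
      by (auto intro!: derivative_eq_intros)
    from has_derivative_compose[OF this d] show ?thesis
      using linear_scale[OF has_derivative_linear[OF d]]
      by (simp add: has_field_derivative_def mult_commute_abs)
  qed
  have D2: "((\<lambda>t. dderiv f (x + \<alpha> *\<^sub>R u + t *\<^sub>R v) u) has_real_derivative dderiv2 f (x + \<alpha> *\<^sub>R u + t *\<^sub>R v) v u) (at t)"
    if "0 \<le> \<alpha>" "\<alpha> \<le> s" "0 \<le> t" "t \<le> s" for t \<alpha>
  proof -
    note d = smooth_on_dderiv2[OF S sub[OF that], of u]
    have "((\<lambda>t. x + \<alpha> *\<^sub>R u + t *\<^sub>R v) has_derivative (\<lambda>h. h *\<^sub>R v)) (at t)"
      by (auto intro!: derivative_eq_intros)
    from has_derivative_compose[OF this d] show ?thesis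
      using linear_scale[OF has_derivative_linear[OF d]]
      by (simp add: has_field_derivative_def mult_commute_abs)
  qed
  have "((\<lambda>t. f (x + t *\<^sub>R u + s *\<^sub>R v) - f (x + t *\<^sub>R u + 0 *\<^sub>R v)) has_real_derivative
      (dderiv f (x + t *\<^sub>R u + s *\<^sub>R v) u - dderiv f (x + t *\<^sub>R u + 0 *\<^sub>R v) u)) (at t)"
    if "0 \<le> t" "t \<le> s" for t
    by (intro DERIV_diff D1) (use that \<open>0 < s\<close> in auto)
  from MVT2[OF \<open>0 < s\<close> this] obtain \<alpha> where \<alpha>: "0 < \<alpha>" "\<alpha> < s"
    "(f (x + s *\<^sub>R u + s *\<^sub>R v) - f (x + s *\<^sub>R u + 0 *\<^sub>R v)) - (f (x + 0 *\<^sub>R u + s *\<^sub>R v) - f (x + 0 *\<^sub>R u + 0 *\<^sub>R v))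
      = (s - 0) * (dderiv f (x + \<alpha> *\<^sub>R u + s *\<^sub>R v) u - dderiv f (x + \<alpha> *\<^sub>R u + 0 *\<^sub>R v) u)"
    by auto
  have "((\<lambda>t. dderiv f (x + \<alpha> *\<^sub>R u + t *\<^sub>R v) u) has_real_derivative dderiv2 f (x + \<alpha> *\<^sub>R u + t *\<^sub>R v) v u) (at t)"
    if "0 \<le> t" "t \<le> s" for t
    by (rule D2) (use that \<alpha> in auto)
  from MVT2[OF \<open>0 < s\<close> this] obtain \<beta> where \<beta>: "0 < \<beta>" "\<beta> < s"
    "dderiv f (x + \<alpha> *\<^sub>R u + s *\<^sub>R v) u - dderiv f (x + \<alpha> *\<^sub>R u + 0 *\<^sub>R v) u
      = (s - 0) * dderiv2 f (x + \<alpha> *\<^sub>R u + \<beta> *\<^sub>R v) v u"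
    by auto
  show ?thesis
    by (rule that[OF \<alpha>(1,2) \<beta>(1,2)]) (use \<alpha>(3) \<beta>(3) in \<open>simp add: power2_eq_square\<close>)
qed

lemma smooth_on_dderiv2_near:
  assumes S: "open S" "smooth_on S f" and x: "x \<in> S" and "0 < e"
  obtains d where "d > 0" "\<And>y. norm (y - x) < d \<Longrightarrow> \<bar>dderiv2 f y a b - dderiv2 f x a b\<bar> < e"
proof -
  have "isCont (\<lambda>y. dderiv2 f y a b) x"
    using smooth_on_continuous_dderiv2[OF S(2)] continuous_on_eq_continuous_at[OF S(1)] x by blast
  then show thesis
    using that \<open>0 < e\<close> unfolding continuous_at_eps_delta dist_norm real_norm_def by blast
qed

text \<open>The second difference is symmetric in \<open>u\<close> and \<open>v\<close>, so a value
  of one mixed derivative near \<open>x\<close> equals a value of the other near \<open>x\<close>;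
  continuity of both moves the equality to \<open>x\<close>.\<close>

lemma dderiv2_commute:
  fixes x u v :: "'a::real_normed_vector"
  assumes S: "open S" "smooth_on S f" and x: "x \<in> S"
  shows "dderiv2 f x u v = dderiv2 f x v u"
proof (rule dense_eq0_I[of "_ - _", simplified])
  fix e :: real assume "0 < e"
  obtain d1 where d1: "d1 > 0" "\<And>y. norm (y - x) < d1 \<Longrightarrow> \<bar>dderiv2 f y u v - dderiv2 f x u v\<bar> < e / 2"
    using smooth_on_dderiv2_near[OF S x half_gt_zero[OF \<open>0 < e\<close>]] by blast
  obtain d2 where d2: "d2 > 0" "\<And>y. norm (y - x) < d2 \<Longrightarrow> \<bar>dderiv2 f y v u - dderiv2 f x v u\<bar> < e / 2"
    using smooth_on_dderiv2_near[OF S x half_gt_zero[OF \<open>0 < e\<close>]] by blast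
  obtain d3 where d3: "d3 > 0" "\<And>y. norm (y - x) < d3 \<Longrightarrow> y \<in> S"
    using S(1) x unfolding open_dist dist_norm by blast
  define d where "d = min d1 (min d2 d3)"
  \<comment> \<open>The summand 1 keeps the denominator positive even for \<open>u = v = 0\<close>
    and places the parallelogram strictly inside the ball of radius \<open>d\<close>.\<close>
  define s where "s = d / (norm u + norm v + 1)"
  have pos: "norm u + norm v + 1 > 0" by (smt (verit) norm_ge_zero)
  have s: "0 < s" using d1 d2 d3 pos by (simp add: s_def d_def)
  have small: "norm (\<alpha> *\<^sub>R u + \<beta> *\<^sub>R v) < d" if "0 \<le> \<alpha>" "\<alpha> \<le> s" "0 \<le> \<beta>" "\<beta> \<le> s" for \<alpha> \<beta>
  proof -
    have "norm (\<alpha> *\<^sub>R u + \<beta> *\<^sub>R v) \<le> \<alpha> * norm u + \<beta> * norm v"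
      using that norm_triangle_ineq[of "\<alpha> *\<^sub>R u" "\<beta> *\<^sub>R v"] by simp
    also have "\<dots> \<le> s * norm u + s * norm v"
      using that by (intro add_mono mult_right_mono) auto
    also have "\<dots> < s * (norm u + norm v + 1)" using s by (simp add: algebra_simps)
    finally show ?thesis using pos by (simp add: s_def)
  qed
  have inS: "x + (\<alpha> *\<^sub>R u + \<beta> *\<^sub>R v) \<in> S" if "0 \<le> \<alpha>" "\<alpha> \<le> s" "0 \<le> \<beta>" "\<beta> \<le> s" for \<alpha> \<beta>
    using small[OF that] by (intro d3) (simp add: d_def)
  obtain \<alpha> \<beta> where A: "0 < \<alpha>" "\<alpha> < s" "0 < \<beta>" "\<beta> < s"
    "f (x + s *\<^sub>R u + s *\<^sub>R v) - f (x + s *\<^sub>R u) - f (x + s *\<^sub>R v) + f x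
      = s\<^sup>2 * dderiv2 f (x + \<alpha> *\<^sub>R u + \<beta> *\<^sub>R v) v u"
    by (rule second_difference[OF S s, of x u v])
       (use inS in \<open>auto simp: add.assoc\<close>)
  obtain \<gamma> \<delta> where B: "0 < \<gamma>" "\<gamma> < s" "0 < \<delta>" "\<delta> < s"
    "f (x + s *\<^sub>R v + s *\<^sub>R u) - f (x + s *\<^sub>R v) - f (x + s *\<^sub>R u) + f x
      = s\<^sup>2 * dderiv2 f (x + \<gamma> *\<^sub>R v + \<delta> *\<^sub>R u) u v"
    by (rule second_difference[OF S s, of x v u])
       (use inS in \<open>auto simp: add.assoc add.commute[of "_ *\<^sub>R v"]\<close>)
  have sw: "x + s *\<^sub>R v + s *\<^sub>R u = x + s *\<^sub>R u + s *\<^sub>R v" by simp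
  have "s\<^sup>2 * dderiv2 f (x + \<alpha> *\<^sub>R u + \<beta> *\<^sub>R v) v u = s\<^sup>2 * dderiv2 f (x + \<gamma> *\<^sub>R v + \<delta> *\<^sub>R u) u v"
    using A(5) B(5) unfolding sw by linarith
  then have eq: "dderiv2 f (x + \<alpha> *\<^sub>R u + \<beta> *\<^sub>R v) v u = dderiv2 f (x + \<gamma> *\<^sub>R v + \<delta> *\<^sub>R u) u v"
    using s by simp
  have "\<bar>dderiv2 f (x + \<gamma> *\<^sub>R v + \<delta> *\<^sub>R u) u v - dderiv2 f x u v\<bar> < e / 2"
    using small[of \<delta> \<gamma>] B by (intro d1) (auto simp: d_def add.assoc add.commute[of "_ *\<^sub>R v"])
  moreover have "\<bar>dderiv2 f (x + \<alpha> *\<^sub>R u + \<beta> *\<^sub>R v) v u - dderiv2 f x v u\<bar> < e / 2"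
    using small[of \<alpha> \<beta>] A by (intro d2) (auto simp: d_def add.assoc)
  ultimately show "\<bar>dderiv2 f x u v - dderiv2 f x v u\<bar> \<le> e" using eq by linarith
qed

lemma bilinear_basis_expand:
  fixes h :: "'a::euclidean_space \<Rightarrow> 'a \<Rightarrow> real"
  assumes "bilinear h"
  shows "h z w = (\<Sum>(b,c)\<in>Basis\<times>Basis. (z \<bullet> b) * (w \<bullet> c) * h b c)"
proof -
  have "h z w = h (\<Sum>b\<in>Basis. (z \<bullet> b) *\<^sub>R b) (\<Sum>b\<in>Basis. (w \<bullet> b) *\<^sub>R b)"
    by (simp add: euclidean_representation)
  also have "\<dots> = (\<Sum>(b,c)\<in>Basis\<times>Basis. h ((z \<bullet> b) *\<^sub>R b) ((w \<bullet> c) *\<^sub>R c))"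
    by (rule bilinear_sum[OF assms])
  finally show ?thesis by (simp add: bilinear_lmul[OF assms] bilinear_rmul[OF assms] mult_ac)
qed

lemma taylor_order2:
  fixes x :: "'a::euclidean_space"
  assumes S: "open S" "smooth_on S f" and x: "x \<in> S" and "0 < e"
  obtains d where "d > 0"
    "\<And>z. norm z < d \<Longrightarrow> x + z \<in> S"
    "\<And>z. norm z < d \<Longrightarrow> \<bar>f (x + z) - f x - dderiv f x z - dderiv2 f x z z / 2\<bar> \<le> e * (norm z)\<^sup>2"
proof -
  \<comment> \<open>Expanding the change of the Hessian in the basis gives
    \<open>(DIM('a))\<^sup>2\<close> terms, each with a coefficient of modulus at most
    \<open>(norm z)\<^sup>2\<close>.\<close>
  define e' where "e' = e / (real DIM('a))\<^sup>2"
  have e': "e' > 0" using \<open>0 < e\<close> by (simp add: e'_def)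
  have near: "\<exists>d>0. \<forall>y. norm (y - x) < d \<longrightarrow> \<bar>dderiv2 f y a b - dderiv2 f x a b\<bar> < e'" for a b
    using smooth_on_dderiv2_near[OF S x e'] by metis
  then obtain D where D: "\<And>a b. D a b > 0"
    "\<And>a b y. norm (y - x) < D a b \<Longrightarrow> \<bar>dderiv2 f y a b - dderiv2 f x a b\<bar> < e'"
    by metis
  obtain d3 where d3: "d3 > 0" "\<And>y. norm (y - x) < d3 \<Longrightarrow> y \<in> S"
    using S(1) x unfolding open_dist dist_norm by blast
  define d where "d = min d3 (Min ((\<lambda>(a,b). D a b) ` (Basis \<times> Basis)))"
  have fin: "finite ((\<lambda>(a,b). D a b) ` (Basis \<times> Basis))" "(\<lambda>(a,b). D a b) ` (Basis \<times> Basis) \<noteq> {}"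
    by auto
  have dD: "d \<le> D a b" if "a \<in> Basis" "b \<in> Basis" for a b
    using that fin by (auto simp: d_def intro!: min.coboundedI2 Min_le)
  have "d > 0" using d3 D fin by (auto simp: d_def Min_gr_iff)
  show ?thesis
  proof (rule that[OF \<open>d > 0\<close>])
    show "x + z \<in> S" if "norm z < d" for z using that d3 by (auto simp: d_def)
    fix z :: 'a assume z: "norm z < d"
    have nt: "norm (t *\<^sub>R z) < d" if "0 \<le> t" "t \<le> 1" for t
      using that z mult_left_le_one_le[of "norm z" t] by simp
    have inS: "x + t *\<^sub>R z \<in> S" if "0 \<le> t" "t \<le> 1" for t
      using nt[OF that] d3 by (auto simp: d_def)
    have aff: "((\<lambda>t. x + t *\<^sub>R z) has_derivative (\<lambda>h. h *\<^sub>R z)) (at t)" for t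
      by (auto intro!: derivative_eq_intros)
    define diff where "diff m t = (if m = 0 then f (x + t *\<^sub>R z) else if m = 1 then dderiv f (x + t *\<^sub>R z) z
        else dderiv2 f (x + t *\<^sub>R z) z z)" for m :: nat and t
    have D1: "((\<lambda>t. f (x + t *\<^sub>R z)) has_real_derivative dderiv f (x + t *\<^sub>R z) z) (at t)"
      if "0 \<le> t" "t \<le> 1" for t
    proof -
      note d = smooth_on_dderiv[OF S inS[OF that]]
      from has_derivative_compose[OF aff d] show ?thesis
        using linear_scale[OF has_derivative_linear[OF d]]
        by (simp add: has_field_derivative_def mult_commute_abs)
    qed
    have D2: "((\<lambda>t. dderiv f (x + t *\<^sub>R z) z) has_real_derivative dderiv2 f (x + t *\<^sub>R z) z z) (at t)"
      if "0 \<le> t" "t \<le> 1" for t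
    proof -
      note d = smooth_on_dderiv2[OF S inS[OF that], of z]
      from has_derivative_compose[OF aff d] show ?thesis
        using linear_scale[OF has_derivative_linear[OF d]]
        by (simp add: has_field_derivative_def mult_commute_abs)
    qed
    have "\<forall>m t. m < 2 \<and> 0 \<le> t \<and> t \<le> 1 \<longrightarrow> DERIV (diff m) t :> diff (Suc m) t"
      using D1 D2 by (auto simp: diff_def[abs_def] less_2_cases_iff)
    from Maclaurin2[OF zero_less_one refl this] obtain t where t: "0 < t" "t \<le> 1"
      "f (x + z) = f x + dderiv f x z + dderiv2 f (x + t *\<^sub>R z) z z / 2"
      by (auto simp: diff_def numeral_2_eq_2)
    have "norm (t *\<^sub>R z) < D b c" if "b \<in> Basis" "c \<in> Basis" for b c
      using nt[of t] t dD[OF that] by linarith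
    then have H: "\<bar>dderiv2 f (x + t *\<^sub>R z) b c - dderiv2 f x b c\<bar> \<le> e'" if "b \<in> Basis" "c \<in> Basis" for b c
      using that D(2)[of "x + t *\<^sub>R z" b c] by (simp add: less_imp_le)
    have "dderiv2 f (x + t *\<^sub>R z) z z - dderiv2 f x z z =
        (\<Sum>(b,c)\<in>Basis\<times>Basis. (z \<bullet> b) * (z \<bullet> c) * (dderiv2 f (x + t *\<^sub>R z) b c - dderiv2 f x b c))"
      by (subst bilinear_basis_expand[OF bilinear_dderiv2[OF S inS]], use t in simp, use t in simp,
          subst bilinear_basis_expand[OF bilinear_dderiv2[OF S x]])
         (simp add: sum_subtractf algebra_simps split_beta)
    also have "\<bar>\<dots>\<bar> \<le> (\<Sum>p\<in>(Basis::'a set)\<times>(Basis::'a set). norm z * norm z * e')"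
      unfolding split_beta
      by (intro order_trans[OF sum_abs] sum_mono)
         (auto simp: abs_mult intro!: mult_mono H Basis_le_norm)
    also have "\<dots> = e * (norm z)\<^sup>2"
      by (simp add: e'_def power2_eq_square card_cartesian_product field_simps)
    finally have "\<bar>dderiv2 f (x + t *\<^sub>R z) z z - dderiv2 f x z z\<bar> \<le> e * (norm z)\<^sup>2" .
    then show "\<bar>f (x + z) - f x - dderiv f x z - dderiv2 f x z z / 2\<bar> \<le> e * (norm z)\<^sup>2"
      unfolding t(3) by (auto simp: abs_le_iff field_simps)
  qed
qed

section \<open>Pluriharmonic functions\<close>

lemma vector_smult_i_i [simp]: "\<i> *s (\<i> *s v) = - (v::complex^'n)"
  by (simp add: vec_eq_iff flip: mult.assoc)

lemma vector_smult_complex: "c *s v = Re c *\<^sub>R v + Im c *\<^sub>R (\<i> *s (v::complex^'n))"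
  by (simp add: vec_eq_iff complex_eq_iff)

lemma bilinear_comp_linear:
  "bilinear h \<Longrightarrow> linear f \<Longrightarrow> linear g \<Longrightarrow> bilinear (\<lambda>u v. h (f u) (g v))"
  unfolding bilinear_def by (auto intro: linear_compose[unfolded o_def])

lemma bilinear_plus: "bilinear h \<Longrightarrow> bilinear k \<Longrightarrow> bilinear (\<lambda>u v. h u v + k u v)"
  unfolding bilinear_def by (auto intro: linear_compose_add)

lemma bilinear_levi:
  assumes "bilinear (H :: complex^'n \<Rightarrow> complex^'n \<Rightarrow> real)"
  shows "bilinear (\<lambda>u v. H u v + H (\<i> *s u) (\<i> *s v))"
  by (intro bilinear_plus assms bilinear_comp_linear[OF assms] bounded_linear.linear bounded_linear_vector_smult)

text \<open>Write M for the real form on the right. The complex Hessian entry at j, k is a quarter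
  of M(e_j, e_k) + i M(e_j, i e_k), and the invariance M(i u, i v) = M(u, v) supplies the remaining
  pairs of real basis vectors.\<close>

lemma ddbar_eq_0_iff:
  fixes x :: "complex^'n"
  assumes S: "open S" "smooth_on S f" "x \<in> S"
  shows "(\<forall>j k. ddbar f x j k = 0) \<longleftrightarrow> (\<forall>u v. dderiv2 f x u v + dderiv2 f x (\<i> *s u) (\<i> *s v) = 0)"
proof -
  let ?H = "dderiv2 f x"
  let ?M = "\<lambda>u v. ?H u v + ?H (\<i> *s u) (\<i> *s v)"
  note bil = bilinear_dderiv2[OF S]
  have i1: "\<i> *s axis j 1 = axis j \<i>" and i2: "\<i> *s axis j \<i> = - axis j (1::complex)" for j :: 'n
    by (auto simp: vec_eq_iff axis_def)
  have ddbar: "ddbar f x j k = 0 \<longleftrightarrow> ?M (axis j 1) (axis k 1) = 0 \<and> ?M (axis j 1) (axis k \<i>) = 0" for j k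
    by (simp add: ddbar_def i1 i2 complex_eq_iff bilinear_rneg[OF bil])
  show ?thesis
  proof
    assume L: "\<forall>j k. ddbar f x j k = 0"
    have "?M = (\<lambda>u v. 0)"
    proof (rule bilinear_eq_stdbasis[OF bilinear_levi[OF bil]])
      show "bilinear (\<lambda>u v. 0 :: real)" by (simp add: bilinear_def module_hom_zero)
      fix a b :: "complex^'n" assume "a \<in> Basis" "b \<in> Basis"
      then obtain j k where "a \<in> {axis j 1, axis j \<i>}" "b \<in> {axis k 1, axis k \<i>}"
        by (auto simp: Basis_vec_def Basis_complex_def)
      moreover have "?M (axis j 1) (axis k 1) = 0" "?M (axis j 1) (axis k \<i>) = 0"
        using L ddbar by auto
      ultimately show "?M a b = 0"
        by (auto simp: i1 i2 bilinear_rneg[OF bil] bilinear_lneg[OF bil])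
    qed
    then show "\<forall>u v. ?M u v = 0" by (simp add: fun_eq_iff)
  qed (simp add: ddbar)
qed

text \<open>The 1-form v \<mapsto> df(i v) is closed because the Levi form vanishes, so on a convex
  set it has a primitive \<open>\<psi>\<close>, obtained by integrating along segments from a base
  point (Poincare lemma). This is the conjugate function up to sign.\<close>

lemma pluriharmonic_on_imp_Re_holo:
  fixes P :: "(complex^'n) set"
  assumes S: "open S" "smooth_on S f" and ph: "pluriharmonic_on S f"
    and P: "convex P" "P \<subseteq> S" "open P"
  obtains h where "holo_on P h" "\<And>x. x \<in> P \<Longrightarrow> Re (h x) = f x"
proof (cases "P = {}")
  case True
  then show thesis using that[of "\<lambda>_. 0"] by (simp add: holo_on_def)
next
  case False
  then obtain a where a: "a \<in> P" by blast
  note lin = has_derivative_linear[OF smooth_on_dderiv[OF S]]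
  note bil = bilinear_dderiv2[OF S]
  let ?J = "\<lambda>v::complex^'n. \<i> *s v"
  have linJ: "linear ?J" by (rule bounded_linear.linear[OF bounded_linear_vector_smult])
  \<comment> \<open>This is the closedness of the 1-form: the derivative of
    \<open>dderiv f y (?J w)\<close> in direction \<open>v\<close> is symmetric in \<open>v\<close>
    and \<open>w\<close>.\<close>
  have swap: "dderiv2 f y v (?J w) = dderiv2 f y w (?J v)" if "y \<in> S" for y v w
  proof -
    have 0: "dderiv2 f y u v = - dderiv2 f y (?J u) (?J v)" for u v
      using ph ddbar_eq_0_iff[OF S that] that by (auto simp: pluriharmonic_on_def eq_neg_iff_add_eq_0)
    show ?thesis
      using 0[of v "?J w"] by (simp add: bilinear_rneg[OF bil[OF that]] dderiv2_commute[OF S that, of w])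
  qed
  define p where "p x t = a + t *\<^sub>R (x - a)" for x t
  have pP: "p x t \<in> P" if "x \<in> P" "0 \<le> t" "t \<le> 1" for x t
    using convexD_alt[OF P(1) a that] by (simp add: p_def algebra_simps)
  have pS: "p x t \<in> S" if "x \<in> P" "0 \<le> t" "t \<le> 1" for x t
    using pP[OF that] P by blast
  define F where "F x t = dderiv f (p x t) (?J (x - a))" for x t
  define F' where "F' x t v = t * dderiv2 f (p x t) v (?J (x - a)) + dderiv f (p x t) (?J v)" for x t v
  \<comment> \<open>Regularity of the derivatives is known for fixed directions; expansion in the
    basis reduces the moving direction \<open>?J (x - a)\<close> to these.\<close>
  have expand: "dderiv f y w = (\<Sum>b\<in>Basis. (w \<bullet> b) * dderiv f y b)" if "y \<in> S" for y w
    using linear_sum[OF lin[OF that], of "\<lambda>b. (w \<bullet> b) *\<^sub>R b" Basis] linear_scale[OF lin[OF that]]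
    by (simp add: euclidean_representation)
  have expand2: "dderiv2 f y u w = (\<Sum>b\<in>Basis. (w \<bullet> b) * dderiv2 f y u b)" if "y \<in> S" for y u w
  proof -
    have l: "linear (dderiv2 f y u)" using bil[OF that] by (simp add: bilinear_def)
    show ?thesis
      using linear_sum[OF l, of "\<lambda>b. (w \<bullet> b) *\<^sub>R b" Basis] linear_scale[OF l]
      by (simp add: euclidean_representation)
  qed
  have dp: "((\<lambda>x. p x t) has_derivative (\<lambda>v. t *\<^sub>R v)) (at x)" for x t
    unfolding p_def by (auto intro!: derivative_eq_intros)
  have dJ: "((\<lambda>x. ?J (x - a)) has_derivative ?J) (at x)" for x
    by (auto intro!: derivative_eq_intros bounded_linear.has_derivative[OF bounded_linear_vector_smult])
  have blF': "bounded_linear (F' x t)" if "x \<in> P" "0 \<le> t" "t \<le> 1" for x t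
  proof -
    have "linear (F' x t)"
      using bil[OF pS[OF that]] lin[OF pS[OF that]] linJ unfolding F'_def bilinear_def
      by (auto intro!: linear_compose_add linear_compose[unfolded o_def, of ?J] linear_compose_scale_right[where 'b=real, simplified])
    then show ?thesis by (simp add: linear_linear)
  qed
  have dF: "((\<lambda>x. F x t) has_derivative F' x t) (at x)" if x: "x \<in> P" and t: "0 \<le> t" "t \<le> 1" for x t
  proof -
    note y = pS[OF x t]
    have "((\<lambda>x. \<Sum>b\<in>Basis. (?J (x - a) \<bullet> b) * dderiv f (p x t) b) has_derivative
        (\<lambda>v. \<Sum>b\<in>Basis. (?J (x - a) \<bullet> b) * dderiv2 f (p x t) (t *\<^sub>R v) b + (?J v \<bullet> b) * dderiv f (p x t) b)) (at x)"
      by (intro has_derivative_sum has_derivative_mult has_derivative_inner_left dJ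
          has_derivative_compose[OF dp smooth_on_dderiv2[OF S y]])
    then have "((\<lambda>x. F x t) has_derivative
        (\<lambda>v. \<Sum>b\<in>Basis. (?J (x - a) \<bullet> b) * dderiv2 f (p x t) (t *\<^sub>R v) b + (?J v \<bullet> b) * dderiv f (p x t) b)) (at x)"
      by (rule has_derivative_transform_within_open[OF _ P(3) x])
         (use t pS in \<open>simp add: F_def flip: expand\<close>)
    also have "(\<lambda>v. \<Sum>b\<in>Basis. (?J (x - a) \<bullet> b) * dderiv2 f (p x t) (t *\<^sub>R v) b + (?J v \<bullet> b) * dderiv f (p x t) b) = F' x t"
      by (rule ext, unfold F'_def sum.distrib expand[OF y, symmetric] expand2[OF y, symmetric])
         (simp add: bilinear_lmul[OF bil[OF y]])
    finally show ?thesis .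
  qed
  have cp: "continuous_on (P \<times> cbox 0 1) (\<lambda>(x, t). p x t)"
    unfolding p_def split_beta by (intro continuous_intros)
  have cd1: "continuous_on S (\<lambda>y. dderiv f y v)" for v
    using smooth_on_dderiv2[OF S] by (meson continuous_at_imp_continuous_on has_derivative_continuous)
  have cd2: "continuous_on S (\<lambda>y. dderiv2 f y u v)" for u v
    by (rule smooth_on_continuous_dderiv2[OF S(2)])
  have cJ: "continuous_on X (\<lambda>q. ?J (g q))" if "continuous_on X g" for X :: "((complex^'n) \<times> real) set" and g
    by (rule bounded_linear.continuous_on[OF bounded_linear_vector_smult that])
  have cF': "continuous_on (P \<times> cbox 0 1) (\<lambda>(x, t). F' x t v)" for v
  proof -
    have "continuous_on (P \<times> cbox 0 1) (\<lambda>q. snd q *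
        (\<Sum>b\<in>Basis. (?J (fst q - a) \<bullet> b) * dderiv2 f (p (fst q) (snd q)) v b) + dderiv f (p (fst q) (snd q)) (?J v))"
      using cp unfolding split_beta
      by (intro continuous_intros cJ continuous_on_compose2[OF cd1] continuous_on_compose2[OF cd2])
         (auto intro!: pS)
    then show ?thesis
      by (rule continuous_on_eq) (auto simp: F'_def pS simp flip: expand2)
  qed
  \<comment> \<open>Differentiation under the integral asks for a derivative that is continuous as
    an operator; in finite dimension this can be tested on basis vectors.\<close>
  have cB: "continuous_on (P \<times> cbox 0 1) (\<lambda>(x, t). Blinfun (F' x t))"
    unfolding continuous_on_def
  proof (intro ballI tendsto_componentwise1)
    fix q v assume q: "q \<in> P \<times> cbox 0 (1::real)" and "v \<in> (Basis :: (complex^'n) set)"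
    have "((\<lambda>(x, t). F' x t v) \<longlongrightarrow> (\<lambda>(x, t). F' x t v) q) (at q within P \<times> cbox 0 1)"
      using cF'[of v] q by (auto simp: continuous_on_def)
    then have "((\<lambda>q. blinfun_apply (case q of (x, t) \<Rightarrow> Blinfun (F' x t)) v) \<longlongrightarrow> (\<lambda>(x, t). F' x t v) q) (at q within P \<times> cbox 0 1)"
      by (rule Lim_transform_within[OF _ zero_less_one])
         (auto simp: bounded_linear_Blinfun_apply blF')
    then show "((\<lambda>q. blinfun_apply (case q of (x, t) \<Rightarrow> Blinfun (F' x t)) v) \<longlongrightarrow>
        blinfun_apply (case q of (x, t) \<Rightarrow> Blinfun (F' x t)) v) (at q within P \<times> cbox 0 1)"
      using q by (auto simp: bounded_linear_Blinfun_apply blF')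
  qed
  have intF: "F x integrable_on cbox 0 1" if x: "x \<in> P" for x
  proof -
    have "continuous_on (cbox 0 1) (\<lambda>t. dderiv f (p x t) (?J (x - a)))"
      by (rule continuous_on_compose2[OF cd1]) (auto simp: p_def intro!: continuous_intros pS[OF x, unfolded p_def])
    then show ?thesis unfolding F_def[abs_def] by (rule integrable_continuous)
  qed
  define \<psi> where "\<psi> x = integral (cbox 0 1) (F x)" for x
  have d\<psi>: "(\<psi> has_derivative (\<lambda>v. dderiv f x (?J v))) (at x)" if x: "x \<in> P" for x
  proof -
    have "((\<lambda>x. integral (cbox 0 1) (F x)) has_derivative
        blinfun_apply (integral (cbox 0 1) (\<lambda>t. Blinfun (F' x t)))) (at x within P)"
      by (rule leibniz_rule[where fx = "\<lambda>x t. Blinfun (F' x t)", OF _ _ _ x P(1)])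
         (use intF cB dF in \<open>auto simp: bounded_linear_Blinfun_apply blF' intro: has_derivative_at_withinI\<close>)
    moreover have "blinfun_apply (integral (cbox 0 1) (\<lambda>t. Blinfun (F' x t))) = (\<lambda>v. dderiv f x (?J v))"
    proof
      fix v
      have "continuous_on (cbox 0 1) (\<lambda>t. case (x, t) of (x, t) \<Rightarrow> Blinfun (F' x t))"
        by (rule continuous_on_compose2[OF cB]) (use x in \<open>auto intro!: continuous_intros\<close>)
      then have "(\<lambda>t. Blinfun (F' x t)) integrable_on cbox 0 1"
        by (intro integrable_continuous) simp
      from blinfun_apply_integral[OF this]
      have "blinfun_apply (integral (cbox 0 1) (\<lambda>t. Blinfun (F' x t))) v
          = integral (cbox 0 1) (\<lambda>t. blinfun_apply (Blinfun (F' x t)) v)" .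
      also have "\<dots> = integral {0..1} (\<lambda>t. F' x t v)"
        unfolding cbox_interval by (rule integral_cong) (use x blF' in \<open>auto simp: bounded_linear_Blinfun_apply\<close>)
      \<comment> \<open>By \<open>swap\<close> the integrand is the derivative of
        \<open>t * dderiv f (p x t) (?J v)\<close> in \<open>t\<close>, so only the endpoint
        \<open>t = 1\<close> contributes.\<close>
      also have "\<dots> = 1 * dderiv f (p x 1) (?J v) - 0 * dderiv f (p x 0) (?J v)"
      proof (rule integral_unique, rule fundamental_theorem_of_calculus)
        fix t :: real assume t: "t \<in> {0..1}"
        then have y: "p x t \<in> S" using pS x by auto
        note d = smooth_on_dderiv2[OF S y, of "?J v"]
        have "((\<lambda>t. p x t) has_derivative (\<lambda>s. s *\<^sub>R (x - a))) (at t)"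
          unfolding p_def by (auto intro!: derivative_eq_intros)
        from has_derivative_compose[OF this d]
        have "((\<lambda>t. dderiv f (p x t) (?J v)) has_real_derivative dderiv2 f (p x t) (x - a) (?J v)) (at t)"
          using bilinear_lmul[OF bil[OF y]] by (simp add: has_field_derivative_def mult_commute_abs)
        then have "((\<lambda>t. t * dderiv f (p x t) (?J v)) has_real_derivative F' x t v) (at t)"
          unfolding F'_def swap[OF y, of v "x - a"] by (auto intro!: derivative_eq_intros)
        then show "((\<lambda>t. t * dderiv f (p x t) (?J v)) has_vector_derivative F' x t v) (at t within {0..1})"
          by (simp add: has_real_derivative_iff_has_vector_derivative has_vector_derivative_at_within)
      qed simp
      finally show "blinfun_apply (integral (cbox 0 1) (\<lambda>t. Blinfun (F' x t))) v = dderiv f x (?J v)"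
        by (simp add: p_def)
    qed
    ultimately show ?thesis
      unfolding \<psi>_def[abs_def] using at_within_open[OF x P(3)] by metis
  qed
  \<comment> \<open>With this sign the derivative is v \<mapsto> df(v) - i df(i v), which is complex
    linear; the opposite sign would make it conjugate linear.\<close>
  define h where "h x = complex_of_real (f x) - \<i> * complex_of_real (\<psi> x)" for x
  show thesis
  proof (rule that[of h])
    show "holo_on P h"
      unfolding holo_on_def
    proof
      fix x assume x: "x \<in> P"
      then have xS: "x \<in> S" using P by blast
      let ?L = "\<lambda>v. complex_of_real (dderiv f x v) - \<i> * complex_of_real (dderiv f x (?J v))"
      have "(h has_derivative ?L) (at x)"
        unfolding h_def[abs_def]
        by (intro has_derivative_diff has_derivative_mult_right has_derivative_of_real smooth_on_dderiv[OF S xS] d\<psi>[OF x])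
      moreover have "?L (c *s v) = c * ?L v" for c v
      proof -
        have "?J (c *s v) = Re c *\<^sub>R ?J v + Im c *\<^sub>R (- v)"
          by (simp add: vec_eq_iff complex_eq_iff)
        then show ?thesis
          unfolding vector_smult_complex[of c v]
          by (simp add: linear_add[OF lin[OF xS]] linear_scale[OF lin[OF xS]] linear_neg[OF lin[OF xS]] linear_diff[OF lin[OF xS]] complex_eq_iff)
      qed
      ultimately show "\<exists>L. (h has_derivative L) (at x within P) \<and> (\<forall>c v. L (c *s v) = c * L v)"
        using has_derivative_at_withinI by blast
    qed
  qed (simp add: h_def)
qed

section \<open>Holomorphic functions of several variables\<close>

lemma holo_onE:
  assumes "holo_on S f" "x \<in> S"
  obtains L where "(f has_derivative L) (at x within S)" "\<And>c v. L (c *s v) = c * L v"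
  using assms unfolding holo_on_def by blast

lemma holo_on_cong:
  assumes "\<And>x. x \<in> S \<Longrightarrow> f x = g x" and "holo_on S f"
  shows "holo_on S g"
  unfolding holo_on_def
proof
  fix x assume "x \<in> S"
  with assms(2) obtain L where "(f has_derivative L) (at x within S)" "\<And>c v. L (c *s v) = c * L v"
    by (auto elim: holo_onE)
  then show "\<exists>L. (g has_derivative L) (at x within S) \<and> (\<forall>c v. L (c *s v) = c * L v)"
    using has_derivative_transform[OF \<open>x \<in> S\<close>, of g f] assms(1) by auto
qed

lemma holo_on_const: "holo_on S (\<lambda>_. c)"
  unfolding holo_on_def by (auto intro!: exI[of _ "\<lambda>_. 0"])

lemma holo_on_component: "holo_on S (\<lambda>z. z $ j)"
  unfolding holo_on_def
  by (auto intro!: exI[of _ "\<lambda>z. z $ j"] bounded_linear.has_derivative[OF bounded_linear_vec_nth] has_derivative_ident)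

lemma holo_on_add:
  assumes "holo_on S f" "holo_on S g"
  shows "holo_on S (\<lambda>x. f x + g x)"
  unfolding holo_on_def
proof
  fix x assume "x \<in> S"
  then obtain L M where "(f has_derivative L) (at x within S)" "\<And>c v. L (c *s v) = c * L v"
    "(g has_derivative M) (at x within S)" "\<And>c v. M (c *s v) = c * M v"
    using assms by (auto elim!: holo_onE)
  then show "\<exists>L. ((\<lambda>x. f x + g x) has_derivative L) (at x within S) \<and> (\<forall>c v. L (c *s v) = c * L v)"
    by (intro exI[of _ "\<lambda>v. L v + M v"]) (auto intro!: has_derivative_add simp: algebra_simps)
qed

lemma holo_on_mult:
  assumes "holo_on S f" "holo_on S g"
  shows "holo_on S (\<lambda>x. f x * g x)"
  unfolding holo_on_def
proof
  fix x assume "x \<in> S"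
  then obtain L M where "(f has_derivative L) (at x within S)" "\<And>c v. L (c *s v) = c * L v"
    "(g has_derivative M) (at x within S)" "\<And>c v. M (c *s v) = c * M v"
    using assms by (auto elim!: holo_onE)
  then show "\<exists>L. ((\<lambda>x. f x * g x) has_derivative L) (at x within S) \<and> (\<forall>c v. L (c *s v) = c * L v)"
    by (intro exI[of _ "\<lambda>v. f x * M v + L v * g x"] conjI has_derivative_mult) (auto simp: algebra_simps)
qed

lemma holo_on_exp:
  assumes "holo_on S f"
  shows "holo_on S (\<lambda>x. exp (f x))"
  unfolding holo_on_def
proof
  fix x assume "x \<in> S"
  then obtain L where L: "(f has_derivative L) (at x within S)" "\<And>c v. L (c *s v) = c * L v"
    using assms by (auto elim!: holo_onE)
  have "(exp has_derivative (\<lambda>h. exp (f x) * h)) (at (f x))"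
    using DERIV_exp[of "f x"] by (simp add: has_field_derivative_def)
  from has_derivative_compose[OF L(1) this] L(2)
  show "\<exists>L. ((\<lambda>x. exp (f x)) has_derivative L) (at x within S) \<and> (\<forall>c v. L (c *s v) = c * L v)"
    by (intro exI[of _ "\<lambda>v. exp (f x) * L v"]) auto
qed

lemma holo_on_translate:
  assumes "holo_on ((\<lambda>z. a + z) ` S) f"
  shows "holo_on S (\<lambda>z. f (a + z))"
  unfolding holo_on_def
proof
  fix x assume "x \<in> S"
  then obtain L where L: "(f has_derivative L) (at (a + x) within (\<lambda>z. a + z) ` S)" "\<And>c v. L (c *s v) = c * L v"
    using assms by (auto elim!: holo_onE)
  have "((\<lambda>z. a + z) has_derivative (\<lambda>v. v)) (at x within S)"
    by (auto intro!: derivative_eq_intros)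
  from has_derivative_in_compose[OF this L(1)] L(2)
  show "\<exists>L. ((\<lambda>z. f (a + z)) has_derivative L) (at x within S) \<and> (\<forall>c v. L (c *s v) = c * L v)"
    by auto
qed

lemma holo_on_subset: "holo_on S f \<Longrightarrow> T \<subseteq> S \<Longrightarrow> holo_on T f"
  unfolding holo_on_def by (blast intro: has_derivative_subset)

lemma holo_on_UNIV_translate:
  assumes "holo_on UNIV f"
  shows "holo_on S (\<lambda>x. f (x - a))"
  using holo_on_subset[OF holo_on_translate[of "- a" UNIV f] subset_UNIV] holo_on_subset[OF assms subset_UNIV]
  by simp

section \<open>Translation to the origin and the case of equality\<close>

lemma set_nn_integral_translate:
  fixes F :: "'a::euclidean_space \<Rightarrow> real"
  assumes P: "open P" and F: "continuous_on ((\<lambda>z. a + z) ` P) F"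
  shows "(\<integral>\<^sup>+ x \<in> (\<lambda>z. a + z) ` P. ennreal (F x) \<partial>lebesgue) = (\<integral>\<^sup>+ z. ennreal (F (a + z)) * indicator P z \<partial>lborel)"
proof -
  let ?G = "\<lambda>x. ennreal (F x) * indicator ((\<lambda>z. a + z) ` P) x"
  have op: "open ((\<lambda>z. a + z) ` P)" using P by (rule open_translation)
  have [measurable]: "?G \<in> borel_measurable borel"
    by (rule borel_measurable_indicator_ennreal) (use F op in auto)
  have "(\<integral>\<^sup>+ x. ?G x \<partial>lebesgue) = (\<integral>\<^sup>+ x. ?G x \<partial>lborel)" by (rule nn_integral_completion)
  also have "\<dots> = (\<integral>\<^sup>+ x. ?G x \<partial>(distr lborel borel ((+) a)))" by (simp add: lborel_distr_plus)
  also have "\<dots> = (\<integral>\<^sup>+ z. ?G (a + z) \<partial>lborel)" by (subst nn_integral_distr) auto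
  also have "\<dots> = (\<integral>\<^sup>+ z. ennreal (F (a + z)) * indicator P z \<partial>lborel)"
    by (intro nn_integral_cong) (auto simp: indicator_def)
  finally show ?thesis .
qed

lemma holo_square_mean_le_imp_eq_1:
  fixes P :: "(complex^'n) set"
  assumes P: "open P" and bal: "\<And>c z. cmod c \<le> 1 \<Longrightarrow> z \<in> P \<Longrightarrow> c *s z \<in> P"
    and fin: "emeasure lborel P < \<infinity>"
    and hol: "holo_on P g" and g0: "g 0 = 1"
    and le: "(\<integral>\<^sup>+ z. ennreal ((cmod (g z))\<^sup>2) * indicator P z \<partial>lborel) \<le> emeasure lborel P"
    and z: "z \<in> P"
  shows "g z = 1"
proof -
  define k where "k z = (g z + 1) / 2" for z
  have holk: "holo_on P k"
    using holo_on_mult[OF holo_on_add[OF hol holo_on_const[of P 1]] holo_on_const[of P "1/2"]]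
    by (simp add: k_def[abs_def])
  have cg: "continuous_on P g" and ck: "continuous_on P k"
    using hol holk by (auto intro: holo_on_imp_continuous_on)
  have m: "P \<in> sets borel" using P by simp
  have "emeasure lborel P = (\<integral>\<^sup>+ z. ennreal ((cmod (k 0))\<^sup>2 * 1) * indicator P z \<partial>lborel)"
    using m by (simp add: k_def g0)
  also have "\<dots> \<le> (\<integral>\<^sup>+ z. ennreal ((cmod (k z))\<^sup>2 * 1) * indicator P z \<partial>lborel)"
    by (rule holo_square_mean_ge[OF P bal holk]) auto
  finally have kge: "emeasure lborel P \<le> (\<integral>\<^sup>+ z. ennreal ((cmod (k z))\<^sup>2) * indicator P z \<partial>lborel)" by simp
  have [measurable]: "(\<lambda>z. ennreal ((cmod (g z))\<^sup>2) * indicator P z) \<in> borel_measurable borel"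
    "(\<lambda>z. ennreal ((cmod (k z))\<^sup>2) * indicator P z) \<in> borel_measurable borel"
    "(\<lambda>z. ennreal ((cmod (g z - 1))\<^sup>2 / 2) * indicator P z) \<in> borel_measurable borel"
    by (intro borel_measurable_indicator_ennreal m continuous_intros cg ck; simp)+
  \<comment> \<open>Parallelogram law for \<open>g\<close> and 1: as the midpoint \<open>k\<close>
    already contributes at least the volume, no room is left for the term with
    \<open>g z - 1\<close>.\<close>
  have par: "2 * (cmod (k z))\<^sup>2 + (cmod (g z - 1))\<^sup>2 / 2 = (cmod (g z))\<^sup>2 + 1" for z
    by (simp add: k_def cmod_power2 norm_divide power_divide) (simp add: power2_eq_square field_simps)
  let ?D = "\<integral>\<^sup>+ z. ennreal ((cmod (g z - 1))\<^sup>2 / 2) * indicator P z \<partial>lborel"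
  have "2 * emeasure lborel P + ?D \<le>
      2 * (\<integral>\<^sup>+ z. ennreal ((cmod (k z))\<^sup>2) * indicator P z \<partial>lborel) + ?D"
    using kge by (intro add_right_mono mult_left_mono) auto
  also have "\<dots> = (\<integral>\<^sup>+ z. 2 * (ennreal ((cmod (k z))\<^sup>2) * indicator P z) + ennreal ((cmod (g z - 1))\<^sup>2 / 2) * indicator P z \<partial>lborel)"
    by (simp add: nn_integral_add nn_integral_cmult)
  also have "\<dots> = (\<integral>\<^sup>+ z. ennreal ((cmod (g z))\<^sup>2) * indicator P z + indicator P z \<partial>lborel)"
  proof (rule nn_integral_cong)
    fix z
    have "2 * ennreal ((cmod (k z))\<^sup>2) + ennreal ((cmod (g z - 1))\<^sup>2 / 2) = ennreal ((cmod (g z))\<^sup>2) + 1"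
      using arg_cong[OF par[of z], of ennreal] by (simp add: ennreal_plus ennreal_mult)
    then show "2 * (ennreal ((cmod (k z))\<^sup>2) * indicator P z) + ennreal ((cmod (g z - 1))\<^sup>2 / 2) * indicator P z
        = ennreal ((cmod (g z))\<^sup>2) * indicator P z + indicator P z"
      by (auto simp: indicator_def)
  qed
  also have "\<dots> \<le> 2 * emeasure lborel P"
    using le m by (subst nn_integral_add) (auto simp: mult_2 intro!: add_mono)
  finally have "2 * emeasure lborel P + ?D \<le> 2 * emeasure lborel P + 0" by simp
  \<comment> \<open>Cancelling the volume in \<open>ennreal\<close> is where its finiteness
    enters.\<close>
  then have "?D = 0"
    using fin by (subst (asm) ennreal_add_left_cancel_le) (auto simp: ennreal_mult_eq_top_iff)
  then have "AE z in lborel. ennreal ((cmod (g z - 1))\<^sup>2 / 2) * indicator P z = 0"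
    by (subst (asm) nn_integral_0_iff_AE) auto
  then have "AE z in lebesgue. ennreal ((cmod (g z - 1))\<^sup>2 / 2) * indicator P z = 0"
    by (rule AE_completion)
  then have "negligible {z. \<not> (ennreal ((cmod (g z - 1))\<^sup>2 / 2) * indicator P z = 0)}"
    unfolding eventually_ae_filter_negligible by (blast intro: negligible_subset)
  moreover have "{z. \<not> (ennreal ((cmod (g z - 1))\<^sup>2 / 2) * indicator P z = 0)} = {z \<in> P. g z \<noteq> 1}"
    by (auto simp: indicator_def)
  ultimately have neg: "negligible {z \<in> P. g z \<noteq> 1}" by simp
  \<comment> \<open>An open null set is empty, which turns almost everywhere into
    everywhere.\<close>
  have "open {z \<in> P. g z \<noteq> 1}"
    using continuous_open_preimage[OF cg P, of "- {1}"] by (simp add: vimage_def Int_def conj_commute open_Compl)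
  then show ?thesis using neg open_not_negligible z by blast
qed

section \<open>Cylinders\<close>

definition cadj :: "complex^'n^'m \<Rightarrow> complex^'m^'n" where
  "cadj A = (\<chi> i j. cnj (A $ j $ i))"

text \<open>A zero entry stands in for the missing coordinate, so that both parts of a point live
  over the same type \<open>complex^'n\<close>.\<close>

definition drop_first :: "complex^'n \<Rightarrow> complex^'n" where
  "drop_first z = (\<chi> i. if i = first_idx then 0 else z $ i)"

definition cyl_axis :: "complex^'n^'n \<Rightarrow> complex^'n" where
  "cyl_axis A = A *v axis first_idx 1"

text \<open>For unitary \<open>A\<close> the matrix \<open>cadj A\<close> is the inverse, so
  \<open>cyl_fst\<close> and \<open>cyl_snd\<close> are coordinates in the frame of
  \<open>A\<close>, in which the cylinder is a plain product.\<close>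

definition cyl_fst :: "complex^'n^'n \<Rightarrow> complex^'n \<Rightarrow> complex" where
  "cyl_fst A z = (cadj A *v z) $ first_idx"

definition cyl_snd :: "complex^'n^'n \<Rightarrow> complex^'n \<Rightarrow> complex^'n" where
  "cyl_snd A z = drop_first (cadj A *v z)"

lemma unitary_cadj:
  assumes "unitary A"
  shows "cadj A *v (A *v z) = z" "A *v (cadj A *v z) = z"
proof -
  have 1: "cadj A ** A = mat 1" using assms by (simp add: unitary_def cadj_def)
  then have 2: "A ** cadj A = mat 1" using matrix_left_right_inverse by blast
  show "cadj A *v (A *v z) = z" "A *v (cadj A *v z) = z"
    by (simp_all add: matrix_vector_mul_assoc 1 2)
qed

lemma bounded_linear_matrix_vector_mult: "bounded_linear (\<lambda>z. (A::complex^'n^'m) *v z)"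
proof -
  have "linear (\<lambda>z. A *v z)"
    by (rule linearI, simp add: matrix_vector_right_distrib)
       (simp add: vec_eq_iff matrix_vector_mult_def scaleR_sum_right)
  then show ?thesis by (simp add: linear_linear)
qed

lemma matrix_vector_mult_smult: "(A::complex^'n^'m) *v (c *s z) = c *s (A *v z)"
  by (simp add: vec_eq_iff matrix_vector_mult_def sum_distrib_left mult_ac)

lemma bounded_linear_drop_first: "bounded_linear (drop_first :: complex^'n \<Rightarrow> complex^'n)"
proof -
  have "linear (drop_first :: complex^'n \<Rightarrow> complex^'n)"
    by (rule linearI) (simp_all add: drop_first_def vec_eq_iff)
  then show ?thesis by (simp add: linear_linear)
qed

lemma norm_drop_first: "norm (drop_first z) = sqrt (\<Sum>i\<in>UNIV - {first_idx}. (cmod (z $ i))\<^sup>2)"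
proof -
  have "(\<Sum>i\<in>UNIV. (cmod (drop_first z $ i))\<^sup>2) = (\<Sum>i\<in>UNIV - {first_idx}. (cmod (z $ i))\<^sup>2)"
    by (rule sum.mono_neutral_cong_right) (auto simp: drop_first_def)
  then show ?thesis by (simp add: norm_vec_def L2_set_def)
qed

lemma bounded_linear_cyl_fst: "bounded_linear (cyl_fst A)"
  unfolding cyl_fst_def[abs_def]
  by (rule bounded_linear_compose[OF bounded_linear_vec_nth bounded_linear_matrix_vector_mult])

lemma bounded_linear_cyl_snd: "bounded_linear (cyl_snd A)"
  unfolding cyl_snd_def[abs_def]
  by (rule bounded_linear_compose[OF bounded_linear_drop_first bounded_linear_matrix_vector_mult])

lemma cyl_fst_smult [simp]: "cyl_fst A (c *s z) = c * cyl_fst A z"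
  by (simp add: cyl_fst_def matrix_vector_mult_smult)

lemma cyl_snd_smult [simp]: "cyl_snd A (c *s z) = c *s cyl_snd A z"
  by (simp add: cyl_snd_def matrix_vector_mult_smult drop_first_def vec_eq_iff)

lemma
  assumes "unitary A"
  shows cyl_fst_axis: "cyl_fst A (cyl_axis A) = 1"
    and cyl_snd_axis: "cyl_snd A (cyl_axis A) = 0"
  by (simp_all add: cyl_fst_def cyl_snd_def cyl_axis_def unitary_cadj[OF assms] drop_first_def vec_eq_iff axis_def)

lemma cyl_decompose:
  assumes "unitary A"
  shows "z = cyl_fst A z *s cyl_axis A + A *v cyl_snd A z"
proof -
  have "cadj A *v z = cyl_fst A z *s axis first_idx 1 + cyl_snd A z"
    by (simp add: cyl_fst_def cyl_snd_def drop_first_def vec_eq_iff axis_def)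
  then have "A *v (cadj A *v z) = A *v (cyl_fst A z *s axis first_idx 1 + cyl_snd A z)" by simp
  then show ?thesis
    by (simp add: unitary_cadj[OF assms] matrix_vector_right_distrib matrix_vector_mult_smult cyl_axis_def)
qed

lemma mem_cyl_iff:
  assumes "unitary A"
  shows "z \<in> cyl A r s \<longleftrightarrow> cmod (cyl_fst A z) < r \<and> norm (cyl_snd A z) < s"
proof -
  have "z \<in> cyl A r s \<longleftrightarrow> cadj A *v z \<in> cyl0 r s"
  proof
    show "z \<in> cyl A r s" if "cadj A *v z \<in> cyl0 r s"
      unfolding cyl_def by (rule image_eqI[OF _ that]) (simp add: unitary_cadj[OF assms])
  qed (auto simp: cyl_def unitary_cadj[OF assms])
  then show ?thesis by (simp add: cyl0_def cyl_fst_def cyl_snd_def norm_drop_first)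
qed

lemma cyl_eq_vimage:
  assumes "unitary A"
  shows "cyl A r s = cyl_fst A -` ball 0 r \<inter> cyl_snd A -` ball 0 s"
  using mem_cyl_iff[OF assms] by auto

lemma open_cyl: "unitary A \<Longrightarrow> open (cyl A r s)"
  unfolding cyl_eq_vimage
  by (intro open_Int open_vimage open_ball linear_continuous_on bounded_linear_cyl_fst bounded_linear_cyl_snd)

lemma convex_cyl: "unitary A \<Longrightarrow> convex (cyl A r s)"
  unfolding cyl_eq_vimage
  by (intro convex_Int convex_linear_vimage convex_ball bounded_linear.linear bounded_linear_cyl_fst bounded_linear_cyl_snd)

lemma zero_in_cyl: "unitary A \<Longrightarrow> 0 < r \<Longrightarrow> 0 < s \<Longrightarrow> 0 \<in> cyl A r s"
  by (simp add: mem_cyl_iff linear_0 bounded_linear.linear[OF bounded_linear_cyl_fst] bounded_linear.linear[OF bounded_linear_cyl_snd])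

lemma balanced_cyl:
  assumes "unitary A" "cmod c \<le> 1" "z \<in> cyl A r s"
  shows "c *s z \<in> cyl A r s"
  using assms(2,3) mult_left_le_one_le[of "cmod (cyl_fst A z)" "cmod c"] mult_left_le_one_le[of "norm (cyl_snd A z)" "cmod c"]
  by (simp add: mem_cyl_iff[OF assms(1)] norm_mult norm_vector_smult)

lemma norm_matrix_vector_mult_le:
  obtains K where "K > 0" "\<And>z. norm ((A::complex^'n^'m) *v z) \<le> K * norm z"
  using bounded_linear.pos_bounded[OF bounded_linear_matrix_vector_mult[of A]] by (metis mult.commute)

lemma bounded_cyl:
  assumes "unitary A"
  shows "bounded (cyl A r s)"
proof -
  obtain K where K: "K > 0" "\<And>z. norm (A *v z) \<le> K * norm z"
    using norm_matrix_vector_mult_le[of A] by blast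
  have "norm z \<le> r * norm (cyl_axis A) + K * s" if "z \<in> cyl A r s" for z
  proof -
    have "norm z \<le> cmod (cyl_fst A z) * norm (cyl_axis A) + K * norm (cyl_snd A z)"
      by (subst cyl_decompose[OF assms, of z], rule order_trans[OF norm_triangle_ineq])
         (simp add: norm_vector_smult K)
    also have "\<dots> \<le> r * norm (cyl_axis A) + K * s"
      using that K(1) by (intro add_mono mult_right_mono mult_left_mono) (auto simp: mem_cyl_iff[OF assms])
    finally show ?thesis .
  qed
  then show ?thesis by (rule boundedI)
qed

lemma lmeasurable_cyl: "unitary A \<Longrightarrow> cyl A r s \<in> lmeasurable"
  by (intro lmeasurable_open bounded_cyl open_cyl)

lemma measure_cyl_pos:
  assumes "unitary A" "0 < r" "0 < s"
  shows "0 < measure lebesgue (cyl A r s)"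
proof -
  have "\<not> negligible (cyl A r s)"
    using open_not_negligible[OF open_cyl[OF assms(1)]] zero_in_cyl[OF assms] by blast
  then show ?thesis
    using lmeasurable_cyl[OF assms(1)] by (simp add: negligible_iff_measure zero_less_measure_iff)
qed

lemma emeasure_cyl: "unitary A \<Longrightarrow> emeasure lborel (cyl A r s) = ennreal (measure lebesgue (cyl A r s))"
  using lmeasurable_cyl[of A r s] open_cyl[of A r s] emeasure_eq_measure2[of "cyl A r s" lebesgue] by simp

text \<open>Two disjoint translates of the half cylinder along its axis fit into the full cylinder.\<close>
lemma measure_cyl_half:
  assumes A: "unitary A" and "0 < r"
  shows "2 * measure lebesgue (cyl A (r / 2) s) \<le> measure lebesgue (cyl A r s)"
proof -
  define v where "v = complex_of_real (r / 2) *s cyl_axis A"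
  let ?C = "cyl A (r / 2) s"
  let ?T = "\<lambda>a. (\<lambda>z. a + z) ` ?C"
  have add: "cyl_fst A (x + y) = cyl_fst A x + cyl_fst A y" "cyl_snd A (x + y) = cyl_snd A x + cyl_snd A y"
    "cyl_fst A (x - y) = cyl_fst A x - cyl_fst A y" "cyl_snd A (x - y) = cyl_snd A x - cyl_snd A y" for x y
    using bounded_linear.linear[OF bounded_linear_cyl_fst[of A]] bounded_linear.linear[OF bounded_linear_cyl_snd[of A]]
    by (simp_all add: linear_add linear_diff)
  have v: "cyl_fst A v = of_real (r / 2)" "cyl_snd A v = 0"
    by (simp_all add: v_def cyl_fst_axis[OF A] cyl_snd_axis[OF A])
  have half: "cmod z < r / 2 \<Longrightarrow> cmod (of_real (r/2) + z) < r \<and> cmod (z - of_real (r/2)) < r" for z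
    using norm_triangle_ineq[of "of_real (r/2)" z] norm_triangle_ineq4[of z "of_real (r/2)"] \<open>0 < r\<close> by simp
  have sub: "?T v \<subseteq> cyl A r s" "?T (- v) \<subseteq> cyl A r s"
    using half by (auto simp: mem_cyl_iff[OF A] add v simp del: of_real_divide)
  have re: "cmod z < r / 2 \<Longrightarrow> - (r / 2) < Re z \<and> Re z < r / 2" for z
    using abs_Re_le_cmod[of z] by linarith
  have disj: "?T v \<inter> ?T (- v) = {}"
  proof -
    have "Re (cyl_fst A z) > 0" if "z \<in> ?T v" for z
      using that re by (fastforce simp: mem_cyl_iff[OF A] add v simp del: of_real_divide)
    moreover have "Re (cyl_fst A z) < 0" if "z \<in> ?T (- v)" for z
      using that re by (fastforce simp: mem_cyl_iff[OF A] add v simp del: of_real_divide)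
    ultimately show ?thesis by fastforce
  qed
  have m: "?T a \<in> lmeasurable" for a
    using lmeasurable_cyl[OF A] by (rule measurable_translation)
  have "2 * measure lebesgue ?C = measure lebesgue (?T v) + measure lebesgue (?T (- v))"
    unfolding measure_translation by simp
  also have "\<dots> = measure lebesgue (?T v \<union> ?T (- v))"
    unfolding measure_Un3[OF m[of v] m[of "- v"]] disj by simp
  also have "\<dots> \<le> measure lebesgue (cyl A r s)"
    using sub fmeasurable.Un[OF m[of v] m[of "- v"]] lmeasurable_cyl[OF A]
    by (intro measure_mono_fmeasurable fmeasurableD) blast+
  finally show ?thesis .
qed

text \<open>The Householder reflection exchanging the first basis vector and \<open>\<xi>\<close>; it needs the
  inner product of the two to be real.\<close>
lemma ex_unitary_axis:
  fixes \<xi> :: "complex^'n"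
  assumes n1: "norm \<xi> = 1" and re: "Im (\<xi> $ first_idx) = 0"
  obtains A where "unitary A" "cyl_axis A = \<xi>"
proof (cases "\<xi> = axis first_idx 1")
  case True
  have "unitary (mat 1 :: complex^'n^'n)"
  proof -
    have "(\<chi> i j. cnj ((mat 1 :: complex^'n^'n) $ j $ i)) = mat 1"
      by (simp add: vec_eq_iff mat_def)
    then show ?thesis by (simp add: unitary_def)
  qed
  then show thesis using that[of "mat 1"] True by (simp add: cyl_axis_def)
next
  case False
  let ?e = "axis first_idx 1 :: complex^'n"
  define w where "w = \<xi> - ?e"
  define N where "N = (norm w)\<^sup>2"
  have N0: "N \<noteq> 0" using False by (simp add: N_def w_def)
  have sumN: "(\<Sum>k\<in>UNIV. w $ k * cnj (w $ k)) = of_real N"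
    by (simp add: complex_norm_square[symmetric] N_def norm_vec_def L2_set_def sum_nonneg)
  define x where "x = Re (\<xi> $ first_idx)"
  have x: "\<xi> $ first_idx = of_real x" using re by (simp add: x_def complex_eq_iff)
  have Nx: "N = 2 - 2 * x"
  proof -
    have "N = \<xi> \<bullet> \<xi> - 2 * (\<xi> \<bullet> ?e) + ?e \<bullet> ?e"
      by (simp add: N_def w_def power2_norm_eq_inner inner_diff_left inner_diff_right inner_commute)
    also have "\<xi> \<bullet> \<xi> = 1" using n1 by (simp add: norm_eq_1)
    also have "\<xi> \<bullet> ?e = x" by (simp add: inner_axis x)
    also have "?e \<bullet> ?e = 1" by (simp add: inner_axis_axis)
    finally show ?thesis by simp
  qed
  define A where "A = (\<chi> i j. (if i = j then 1 else 0) - 2 * w $ i * cnj (w $ j) / of_real N)"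
  have adj: "(\<chi> i j. cnj (A $ j $ i)) = A"
    by (simp add: A_def vec_eq_iff)
  have "(A ** A) $ i $ j = mat 1 $ i $ j" for i j
  proof -
    \<comment> \<open>Coefficient of the squared rank one term; multiplied by \<open>N\<close> it
      cancels the two mixed terms.\<close>
    define C where "C = 4 * w $ i * cnj (w $ j) / (of_real N)\<^sup>2"
    have "(A ** A) $ i $ j = (\<Sum>k\<in>UNIV. ((if i = k then 1 else 0) - 2 * w $ i * cnj (w $ k) / of_real N)
        * ((if k = j then 1 else 0) - 2 * w $ k * cnj (w $ j) / of_real N))"
      by (simp add: A_def matrix_matrix_mult_def)
    also have "\<dots> = (\<Sum>k\<in>UNIV. (if k = i then (if i = j then 1 else 0) - 2 * w $ i * cnj (w $ j) / of_real N else 0)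
        - (if k = j then 2 * w $ i * cnj (w $ j) / of_real N else 0)
        + C * (w $ k * cnj (w $ k)))"
      by (rule sum.cong) (auto simp: C_def algebra_simps power2_eq_square)
    also have "\<dots> = (if i = j then 1 else 0) - 4 * w $ i * cnj (w $ j) / of_real N
        + C * of_real N"
      by (simp add: sum.distrib sum_subtractf sumN flip: sum_distrib_left)
    also have "\<dots> = mat 1 $ i $ j"
      using N0 by (simp add: C_def mat_def power2_eq_square)
    finally show ?thesis .
  qed
  then have uni: "unitary A" unfolding unitary_def adj by (simp add: vec_eq_iff)
  have "cyl_axis A = \<xi>"
  proof -
    have "(A *v ?e) $ i = (if i = first_idx then 1 else 0) - 2 * w $ i * cnj (w $ first_idx) / of_real N" for i
      by (simp add: A_def matrix_vector_mult_def axis_def if_distrib cong: if_cong)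
    also have "\<dots> i = (if i = first_idx then 1 else 0) + w $ i" for i
    proof -
      \<comment> \<open>The first entry of \<open>w\<close> is \<open>x - 1\<close>, which is
        \<open>- N / 2\<close> by \<open>Nx\<close>. Here the first entry of \<open>\<xi>\<close>
        has to be real.\<close>
      have "cnj (w $ first_idx) = - of_real N / 2" by (simp add: w_def x Nx complex_eq_iff)
      then show ?thesis using N0 by simp
    qed
    also have "\<dots> i = \<xi> $ i" for i by (simp add: w_def axis_def)
    finally show ?thesis by (simp add: cyl_axis_def vec_eq_iff)
  qed
  then show thesis using that uni by blast
qed

section \<open>The Levi form on thin cylinders\<close>

lemma complex_linearI:
  fixes L :: "complex^'n \<Rightarrow> complex"
  assumes "linear L" "\<And>v. L (\<i> *s v) = \<i> * L v"
  shows "L (c *s v) = c * L v"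
  unfolding vector_smult_complex[of c v] linear_add[OF assms(1)] linear_scale[OF assms(1)] assms(2)
  by (simp add: complex_eq_iff)

text \<open>Invariance under multiplying both arguments by i makes the mixed terms in u and i u
  cancel. On the axis of a cylinder the Levi form is therefore a multiple of a squared modulus,
  which is constant along rotations.\<close>

lemma levi_rotate:
  fixes H :: "complex^'n \<Rightarrow> complex^'n \<Rightarrow> real"
  assumes bil: "bilinear H"
  defines "M \<equiv> \<lambda>u v. H u v + H (\<i> *s u) (\<i> *s v)"
  shows "M (c *s u) (c *s u) = (cmod c)\<^sup>2 * M u u"
proof -
  have bM: "bilinear M" unfolding M_def by (rule bilinear_levi[OF bil])
  have MJ: "M (\<i> *s u) (\<i> *s u) = M u u" "M (\<i> *s u) u = - M u (\<i> *s u)"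
    by (simp_all add: M_def bilinear_lneg[OF bil] bilinear_rneg[OF bil])
  show ?thesis
    unfolding vector_smult_complex[of c u] bilinear_ladd[OF bM] bilinear_radd[OF bM]
      bilinear_lmul[OF bM] bilinear_rmul[OF bM] MJ cmod_power2
    by (simp add: algebra_simps power2_eq_square)
qed

text \<open>The real quadratic Taylor polynomial is the real part of the holomorphic polynomial \<open>q\<close>
  plus the Levi form; on a thin cylinder only the value of the latter on the axis matters.\<close>
lemma levi_local_model:
  fixes a :: "complex^'n"
  assumes S: "open S" "smooth_on S f" and a: "a \<in> S" and A: "unitary A" and "0 < \<eta>"
  defines "M \<equiv> \<lambda>u v. dderiv2 f a u v + dderiv2 f a (\<i> *s u) (\<i> *s v)"
  obtains q \<delta> \<rho> where "holo_on UNIV q" "q 0 = 0" "0 < \<delta>" "0 < \<rho>"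
    "\<And>r z. \<lbrakk>0 < r; r < \<rho>; z \<in> cyl A r (\<delta> * r)\<rbrakk> \<Longrightarrow> a + z \<in> S"
    "\<And>r z. \<lbrakk>0 < r; r < \<rho>; z \<in> cyl A r (\<delta> * r)\<rbrakk> \<Longrightarrow>
      \<bar>f (a + z) - f a - Re (q z) - M (cyl_axis A) (cyl_axis A) / 4 * (cmod (cyl_fst A z))\<^sup>2\<bar> \<le> \<eta> * r\<^sup>2"
proof -
  let ?J = "\<lambda>v::complex^'n. \<i> *s v"
  let ?H = "dderiv2 f a"
  let ?\<xi> = "cyl_axis A"
  note bH = bilinear_dderiv2[OF S a]
  note lin = has_derivative_linear[OF smooth_on_dderiv[OF S a]]
  have linJ: "linear ?J" by (rule bounded_linear.linear[OF bounded_linear_vector_smult])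
  have bM: "bilinear M" unfolding M_def by (rule bilinear_levi[OF bH])
  \<comment> \<open>\<open>l\<close> is the complex linear form with real part
    \<open>dderiv f a\<close>. Removing the Levi part from half the Hessian leaves (H(u, v) - H(i u,
    i v)) / 4 as the real part of \<open>B\<close>; its imaginary part is then forced by B(i u, v) =
    i B(u, v).\<close>
  define l where "l v = complex_of_real (dderiv f a v) - \<i> * complex_of_real (dderiv f a (?J v))" for v
  define B where "B u v = complex_of_real ((?H u v - ?H (?J u) (?J v)) / 4)
      - \<i> * complex_of_real ((?H u (?J v) + ?H (?J u) v) / 4)" for u v
  define q where "q z = l z + B z z" for z
  have Jadd: "?J (u + v) = ?J u + ?J v" "?J (c *\<^sub>R u) = c *\<^sub>R ?J u" for u v c
    using linJ by (simp_all add: linear_add linear_scale)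
  have linl: "linear l"
    by (rule linearI) (simp_all add: l_def Jadd linear_add[OF lin] linear_scale[OF lin] complex_eq_iff)
  have cl: "l (c *s v) = c * l v" for c v
    by (rule complex_linearI[OF linl]) (simp add: l_def linear_neg[OF lin] complex_eq_iff)
  have bB: "bilinear B"
    unfolding bilinear_def
    by (auto intro!: linearI simp: B_def Jadd bilinear_ladd[OF bH] bilinear_radd[OF bH]
      bilinear_lmul[OF bH] bilinear_rmul[OF bH] complex_eq_iff field_simps)
  have clB: "B (c *s u) v = c * B u v" for c u v
  proof (rule complex_linearI)
    show "linear (\<lambda>u. B u v)" using bB by (simp add: bilinear_def)
  qed (simp add: B_def bilinear_lneg[OF bH] bilinear_rneg[OF bH] complex_eq_iff field_simps)
  have crB: "B u (c *s v) = c * B u v" for c u v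
  proof (rule complex_linearI)
    show "linear (B u)" using bB by (simp add: bilinear_def)
  qed (simp add: B_def bilinear_lneg[OF bH] bilinear_rneg[OF bH] complex_eq_iff field_simps)
  have holq: "holo_on UNIV q"
    unfolding holo_on_def
  proof
    fix x :: "complex^'n"
    have "((\<lambda>z. B z z) has_derivative (\<lambda>v. B x v + B v x)) (at x)"
      using bB unfolding bilinear_conv_bounded_bilinear
      by (rule bounded_bilinear.FDERIV[OF _ has_derivative_ident has_derivative_ident])
    moreover have "(l has_derivative l) (at x)"
      using linl by (simp add: linear_linear bounded_linear_imp_has_derivative)
    ultimately have "(q has_derivative (\<lambda>v. l v + (B x v + B v x))) (at x)"
      unfolding q_def[abs_def] by (intro has_derivative_add)
    then show "\<exists>L. (q has_derivative L) (at x) \<and> (\<forall>c v. L (c *s v) = c * L v)"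
      by (intro exI[of _ "\<lambda>v. l v + (B x v + B v x)"]) (simp add: cl clB crB algebra_simps)
  qed
  have q0: "q 0 = 0" by (simp add: q_def linear_0[OF linl] bilinear_lzero[OF bB])
  have Req: "Re (q z) = dderiv f a z + ?H z z / 2 - M z z / 4" for z
    by (simp add: q_def l_def B_def M_def field_simps)
  obtain K where K: "K > 0" "\<And>z. norm (A *v z) \<le> K * norm z"
    using norm_matrix_vector_mult_le[of A] by blast
  obtain b where b: "b > 0" "\<And>u v. \<bar>M u v\<bar> \<le> b * norm u * norm v"
    using bilinear_bounded_pos[OF bM] by auto
  define n where "n = norm ?\<xi>"
  have n: "n \<ge> 0" by (simp add: n_def)
  \<comment> \<open>The axis part of \<open>z\<close> has norm at most \<open>n * r\<close>, the
    transverse part at most \<open>K * (\<delta> * r)\<close>; two cross terms and the transverse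
    square add up to at most \<open>C * \<delta> * r\<^sup>2\<close>. The choice of
    \<open>\<delta>\<close> caps this at half of the allowed error, and \<open>e\<close> does the
    same for the Taylor remainder because \<open>norm z \<le> (n + K) * r\<close>.\<close>
  define C where "C = b * (2 * n * K + K\<^sup>2)"
  have C: "C > 0" using b K n by (auto simp: C_def intro!: mult_pos_pos add_nonneg_pos)
  define \<delta> where "\<delta> = min 1 (\<eta> / (2 * C))"
  have \<delta>: "0 < \<delta>" "\<delta> \<le> 1" "C * \<delta> \<le> \<eta> / 2"
  proof -
    have "C * \<delta> \<le> C * (\<eta> / (2 * C))" using C by (intro mult_left_mono) (auto simp: \<delta>_def)
    then show "C * \<delta> \<le> \<eta> / 2" using C by simp
  qed (use C \<open>0 < \<eta>\<close> in \<open>auto simp: \<delta>_def\<close>)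
  define e where "e = \<eta> / (2 * (n + K)\<^sup>2)"
  have nK: "n + K > 0" using n K by simp
  have e: "e > 0" using \<open>0 < \<eta>\<close> nK by (simp add: e_def)
  obtain d where d: "d > 0" "\<And>z. norm z < d \<Longrightarrow> a + z \<in> S"
    "\<And>z. norm z < d \<Longrightarrow> \<bar>f (a + z) - f a - dderiv f a z - ?H z z / 2\<bar> \<le> e * (norm z)\<^sup>2"
    using taylor_order2[OF S a e] by blast
  define \<rho> where "\<rho> = d / (n + K)"
  have \<rho>: "\<rho> > 0" using d nK by (simp add: \<rho>_def)
  have main: "a + z \<in> S \<and> \<bar>f (a + z) - f a - Re (q z) - M ?\<xi> ?\<xi> / 4 * (cmod (cyl_fst A z))\<^sup>2\<bar> \<le> \<eta> * r\<^sup>2"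
    if r: "0 < r" "r < \<rho>" and z: "z \<in> cyl A r (\<delta> * r)" for r z
  proof -
    define w where "w = cyl_fst A z"
    define y where "y = A *v cyl_snd A z"
    have zdec: "z = w *s ?\<xi> + y" unfolding w_def y_def by (rule cyl_decompose[OF A])
    have w: "cmod w < r" using z by (simp add: mem_cyl_iff[OF A] w_def)
    have "norm (cyl_snd A z) \<le> \<delta> * r" using z by (simp add: mem_cyl_iff[OF A])
    then have "K * norm (cyl_snd A z) \<le> K * (\<delta> * r)" using K(1) by (intro mult_left_mono) auto
    then have y: "norm y \<le> K * (\<delta> * r)" using K(2)[of "cyl_snd A z"] by (simp add: y_def)
    have "K * (\<delta> * r) \<le> K * r"
      using \<delta> K(1) r mult_left_le_one_le[of r \<delta>] by (intro mult_left_mono) auto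
    then have y': "norm y \<le> K * r" using y by linarith
    have w\<xi>: "norm (w *s ?\<xi>) \<le> n * r"
      using w n mult_right_mono[of "cmod w" r n] by (simp add: norm_vector_smult n_def mult.commute)
    have nz: "norm z \<le> (n + K) * r"
      using norm_triangle_ineq[of "w *s ?\<xi>" y] w\<xi> y' by (simp add: zdec algebra_simps)
    also have "\<dots> < d" using r nK by (simp add: \<rho>_def field_simps)
    finally have zd: "norm z < d" .
    have T: "\<bar>f (a + z) - f a - dderiv f a z - ?H z z / 2\<bar> \<le> \<eta> / 2 * r\<^sup>2"
    proof -
      have "e * (norm z)\<^sup>2 \<le> e * ((n + K) * r)\<^sup>2"
        using e nz by (intro mult_left_mono power_mono) auto
      also have "\<dots> = \<eta> / 2 * r\<^sup>2" using nK by (simp add: e_def power_mult_distrib)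
      finally show ?thesis using d(3)[OF zd] by linarith
    qed
    have "M z z = M (w *s ?\<xi>) (w *s ?\<xi>) + M (w *s ?\<xi>) y + M y (w *s ?\<xi>) + M y y"
      unfolding zdec bilinear_ladd[OF bM] bilinear_radd[OF bM] by simp
    moreover have "M (w *s ?\<xi>) (w *s ?\<xi>) = (cmod w)\<^sup>2 * M ?\<xi> ?\<xi>"
      unfolding M_def by (rule levi_rotate[OF bH])
    ultimately have "M z z - (cmod w)\<^sup>2 * M ?\<xi> ?\<xi> = M (w *s ?\<xi>) y + M y (w *s ?\<xi>) + M y y" by simp
    moreover have "\<bar>M (w *s ?\<xi>) y\<bar> \<le> b * (n * r) * (K * (\<delta> * r))" "\<bar>M y (w *s ?\<xi>)\<bar> \<le> b * (n * r) * (K * (\<delta> * r))"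
    proof -
      have "b * norm (w *s ?\<xi>) * norm y \<le> b * (n * r) * (K * (\<delta> * r))"
        using b w\<xi> y n r by (intro mult_mono) auto
      then show "\<bar>M (w *s ?\<xi>) y\<bar> \<le> b * (n * r) * (K * (\<delta> * r))" "\<bar>M y (w *s ?\<xi>)\<bar> \<le> b * (n * r) * (K * (\<delta> * r))"
        using b(2)[of "w *s ?\<xi>" y] b(2)[of y "w *s ?\<xi>"] by (simp_all add: mult_ac)
    qed
    moreover have "\<bar>M y y\<bar> \<le> b * (K * r) * (K * (\<delta> * r))"
    proof -
      have "b * norm y * norm y \<le> b * (K * r) * (K * (\<delta> * r))"
        using b y y' K r by (intro mult_mono) auto
      then show ?thesis using b(2)[of y y] by simp
    qed
    ultimately have "\<bar>M z z - (cmod w)\<^sup>2 * M ?\<xi> ?\<xi>\<bar> \<le> 2 * (b * (n * r) * (K * (\<delta> * r))) + b * (K * r) * (K * (\<delta> * r))"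
      by linarith
    also have "\<dots> = C * \<delta> * r\<^sup>2" by (simp add: C_def algebra_simps power2_eq_square)
    also have "\<dots> \<le> \<eta> / 2 * r\<^sup>2" using \<delta> by (intro mult_right_mono) auto
    finally have X: "\<bar>M z z - (cmod w)\<^sup>2 * M ?\<xi> ?\<xi>\<bar> \<le> \<eta> / 2 * r\<^sup>2" .
    have "\<bar>x / 4\<bar> \<le> \<bar>x\<bar>" for x :: real by (cases "x \<ge> 0") auto
    then have "\<bar>(M z z - (cmod w)\<^sup>2 * M ?\<xi> ?\<xi>) / 4\<bar> \<le> \<eta> / 2 * r\<^sup>2"
      using X order_trans by blast
    moreover have "(M z z - (cmod w)\<^sup>2 * M ?\<xi> ?\<xi>) / 4 = M z z / 4 - M ?\<xi> ?\<xi> / 4 * (cmod w)\<^sup>2"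
      by (simp add: field_simps)
    ultimately have L: "\<bar>M z z / 4 - M ?\<xi> ?\<xi> / 4 * (cmod w)\<^sup>2\<bar> \<le> \<eta> / 2 * r\<^sup>2" by simp
    have "\<eta> / 2 * r\<^sup>2 + \<eta> / 2 * r\<^sup>2 = \<eta> * r\<^sup>2" by simp
    then have "\<bar>f (a + z) - f a - Re (q z) - M ?\<xi> ?\<xi> / 4 * (cmod w)\<^sup>2\<bar> \<le> \<eta> * r\<^sup>2"
      using T L unfolding Req by linarith
    then show ?thesis using d(2)[OF zd] by (simp add: w_def)
  qed
  show thesis by (rule that[OF holq q0 \<delta>(1) \<rho>]) (use main in blast)+
qed

text \<open>Weights are estimated by one constant on the half cylinder and another on the rest. By
  \<open>measure_cyl_half\<close> the rest has at least half of the volume, so a gain there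
  outweighs a smaller loss inside.\<close>

lemma nn_integral_cyl_two_levels:
  fixes A :: "complex^'n^'n" and r s :: real
  assumes A: "unitary A" and r: "0 < r" and c: "0 \<le> c1" "0 \<le> c2"
  defines "m \<equiv> measure lebesgue (cyl A (r / 2) s)" and "V \<equiv> measure lebesgue (cyl A r s)"
  shows "(\<integral>\<^sup>+ z. ennreal (if z \<in> cyl A (r / 2) s then c1 else c2) * indicator (cyl A r s) z \<partial>lborel)
    = ennreal (c1 * m + c2 * (V - m))"
proof -
  let ?P = "cyl A r s" and ?Q = "cyl A (r / 2) s"
  have sub: "?Q \<subseteq> ?P" using r by (auto simp: mem_cyl_iff[OF A])
  have meas [measurable]: "?P \<in> sets borel" "?Q \<in> sets borel" using open_cyl[OF A] by auto
  have le: "m \<le> V" unfolding m_def V_def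
    by (rule measure_mono_fmeasurable) (use sub lmeasurable_cyl[OF A] in auto)
  have "(\<integral>\<^sup>+ z. ennreal (if z \<in> ?Q then c1 else c2) * indicator ?P z \<partial>lborel)
      = (\<integral>\<^sup>+ z. ennreal c1 * indicator ?Q z + ennreal c2 * indicator (?P - ?Q) z \<partial>lborel)"
    using sub by (intro nn_integral_cong) (auto simp: indicator_def)
  also have "\<dots> = ennreal c1 * emeasure lborel ?Q + ennreal c2 * emeasure lborel (?P - ?Q)"
    by (subst nn_integral_add) (auto simp: nn_integral_cmult_indicator)
  also have "emeasure lborel (?P - ?Q) = ennreal V - ennreal m"
    using sub by (subst emeasure_Diff) (auto simp: emeasure_cyl[OF A] m_def V_def)
  also have "\<dots> = ennreal (V - m)" by (rule ennreal_minus) (simp add: m_def)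
  also have "emeasure lborel ?Q = ennreal m" by (simp add: emeasure_cyl[OF A] m_def)
  also have "ennreal c1 * ennreal m + ennreal c2 * ennreal (V - m) = ennreal (c1 * m + c2 * (V - m))"
    using c le by (simp add: ennreal_mult ennreal_plus m_def)
  finally show ?thesis .
qed

section \<open>Existence, uniqueness and the sign of the Levi form\<close>

definition opt_ext :: "(complex^'n \<Rightarrow> real) \<Rightarrow> complex^'n \<Rightarrow> (complex^'n) set \<Rightarrow> (complex^'n \<Rightarrow> complex) \<Rightarrow> bool" where
  "opt_ext \<phi> a P f \<longleftrightarrow> holo_on ((\<lambda>z. a + z) ` P) f \<and>
            (\<forall>x. x \<notin> (\<lambda>z. a + z) ` P \<longrightarrow> f x = 0) \<and>
            f a = 1 \<and>
            (\<integral>\<^sup>+ x \<in> (\<lambda>z. a + z) ` P. ennreal ((cmod (f x))\<^sup>2 * exp (- \<phi> x)) \<partial>lebesgue)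
              \<le> emeasure lebesgue P * ennreal (exp (- \<phi> a))"

lemma nn_integral_ext_translate:
  assumes P: "open P" and \<phi>: "continuous_on ((\<lambda>z. a + z) ` P) \<phi>" and f: "holo_on ((\<lambda>z. a + z) ` P) f"
  shows "(\<integral>\<^sup>+ x \<in> (\<lambda>z. a + z) ` P. ennreal ((cmod (f x))\<^sup>2 * exp (- \<phi> x)) \<partial>lebesgue)
    = (\<integral>\<^sup>+ z. ennreal ((cmod (f (a + z)))\<^sup>2 * exp (- \<phi> (a + z))) * indicator P z \<partial>lborel)"
  by (rule set_nn_integral_translate[OF P])
     (intro continuous_intros \<phi> holo_on_imp_continuous_on[OF f])

lemma opt_ext_imp_levi_nonneg:
  fixes a :: "complex^'n"
  assumes S: "open S" "smooth_on S \<phi>" and a: "a \<in> S" and A: "unitary A"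
    and ex: "\<And>r s. (a, r, s, A) \<in> Omega_td S \<Longrightarrow> \<exists>f. opt_ext \<phi> a (cyl A r s) f"
  defines "M \<equiv> \<lambda>u v. dderiv2 \<phi> a u v + dderiv2 \<phi> a (\<i> *s u) (\<i> *s v)"
  shows "M (cyl_axis A) (cyl_axis A) \<ge> 0"
proof (rule ccontr)
  define \<mu> where "\<mu> = - M (cyl_axis A) (cyl_axis A) / 4"
  assume "\<not> ?thesis"
  then have \<mu>: "\<mu> > 0" by (simp add: \<mu>_def)
  obtain q \<delta> \<rho> where q: "holo_on UNIV q" "q 0 = 0" and \<delta>: "0 < \<delta>" and \<rho>: "0 < \<rho>"
    and inS: "\<And>r z. \<lbrakk>0 < r; r < \<rho>; z \<in> cyl A r (\<delta> * r)\<rbrakk> \<Longrightarrow> a + z \<in> S"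
    and mod: "\<And>r z. \<lbrakk>0 < r; r < \<rho>; z \<in> cyl A r (\<delta> * r)\<rbrakk> \<Longrightarrow>
      \<bar>\<phi> (a + z) - \<phi> a - Re (q z) - M (cyl_axis A) (cyl_axis A) / 4 * (cmod (cyl_fst A z))\<^sup>2\<bar> \<le> \<mu> / 16 * r\<^sup>2"
    using levi_local_model[OF S a A, of "\<mu> / 16"] \<mu> unfolding M_def by (metis divide_pos_pos zero_less_numeral)
  define r where "r = \<rho> / 2"
  have r: "0 < r" "r < \<rho>" using \<rho> by (auto simp: r_def)
  define s where "s = \<delta> * r"
  have s: "0 < s" using \<delta> r by (simp add: s_def)
  let ?P = "cyl A r s" and ?Q = "cyl A (r / 2) s"
  let ?T = "(\<lambda>z. a + z) ` ?P"
  define V where "V = measure lebesgue ?P"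
  define m where "m = measure lebesgue ?Q"
  have V: "V > 0" unfolding V_def by (rule measure_cyl_pos[OF A r(1) s])
  have m: "2 * m \<le> V" unfolding V_def m_def by (rule measure_cyl_half[OF A r(1)])
  have TS: "?T \<subseteq> S" using inS[OF r] by (auto simp: s_def)
  then have "(a, r, s, A) \<in> Omega_td S" using a A r s by (simp add: Omega_td_def)
  from ex[OF this] obtain f where f: "opt_ext \<phi> a ?P f" by blast
  have opP: "open ?P" by (rule open_cyl[OF A])
  have holf: "holo_on ?T f" and f1: "f a = 1"
    and fle: "(\<integral>\<^sup>+ x \<in> ?T. ennreal ((cmod (f x))\<^sup>2 * exp (- \<phi> x)) \<partial>lebesgue) \<le> emeasure lebesgue ?P * ennreal (exp (- \<phi> a))"
    using f by (auto simp: opt_ext_def)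
  have c\<phi>: "continuous_on ?T \<phi>"
    using smooth_on_imp_continuous_on[OF S(2)] TS continuous_on_subset by blast
  \<comment> \<open>The factor absorbs the holomorphic part of the Taylor polynomial. What remains
    of the weight depends only on \<open>cmod (cyl_fst A z)\<close>, as the rotation invariance in
    \<open>holo_square_mean_ge\<close> demands.\<close>
  define g where "g z = f (a + z) * exp (q z * (- 1 / 2))" for z
  have holg: "holo_on ?P g"
    unfolding g_def[abs_def]
    by (intro holo_on_mult holo_on_exp holo_on_const holo_on_translate[OF holf] holo_on_subset[OF q(1)]) auto
  have g0: "g 0 = 1" by (simp add: g_def f1 q)
  define x where "x = \<mu> * r\<^sup>2"
  have x: "x > 0" using \<mu> r by (simp add: x_def)
  \<comment> \<open>Subtracting the model error \<open>x / 16\<close> makes \<open>W z\<close> a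
    lower bound for \<open>exp (Re (q z) - \<phi> (a + z))\<close> on the cylinder.\<close>
  define W where "W z = exp (- \<phi> a) * exp (\<mu> * (cmod (cyl_fst A z))\<^sup>2 - x / 16)" for z
  have W0: "W z \<ge> 0" for z by (simp add: W_def)
  have cW: "continuous_on ?P W"
    unfolding W_def[abs_def]
    by (intro continuous_intros linear_continuous_on bounded_linear_cyl_fst)
  have Wle: "(cmod (g z))\<^sup>2 * W z \<le> (cmod (f (a + z)))\<^sup>2 * exp (- \<phi> (a + z))" if "z \<in> ?P" for z
  proof -
    have "(cmod (g z))\<^sup>2 = (cmod (f (a + z)))\<^sup>2 * exp (- Re (q z))"
      by (simp add: g_def norm_mult power_mult_distrib flip: exp_double)
    then have "(cmod (g z))\<^sup>2 * W z = (cmod (f (a + z)))\<^sup>2 * exp (- Re (q z) - \<phi> a + (\<mu> * (cmod (cyl_fst A z))\<^sup>2 - x / 16))"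
      by (simp add: W_def flip: exp_add)
    also have "\<dots> \<le> (cmod (f (a + z)))\<^sup>2 * exp (- \<phi> (a + z))"
      using mod[OF r, of z] that by (intro mult_left_mono) (auto simp: \<mu>_def x_def s_def abs_le_iff field_simps)
    finally show ?thesis .
  qed
  \<comment> \<open>Outside the half cylinder the exponent gains
    \<open>\<mu> * (r / 2)\<^sup>2 = 4 * x / 16\<close>, of which the error leaves 3/16.\<close>
  let ?c1 = "exp (- \<phi> a) * exp (- x / 16)" and ?c2 = "exp (- \<phi> a) * exp (3 * x / 16)"
  have "ennreal (?c1 * m + ?c2 * (V - m))
      = (\<integral>\<^sup>+ z. ennreal (if z \<in> ?Q then ?c1 else ?c2) * indicator ?P z \<partial>lborel)"
    unfolding V_def m_def by (rule nn_integral_cyl_two_levels[OF A r(1), symmetric]) auto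
  also have "\<dots> \<le> (\<integral>\<^sup>+ z. ennreal ((cmod (g 0))\<^sup>2 * W z) * indicator ?P z \<partial>lborel)"
  proof (intro nn_integral_mono)
    fix z
    have "(if z \<in> ?Q then ?c1 else ?c2) \<le> W z" if z: "z \<in> ?P"
    proof (cases "z \<in> ?Q")
      case True
      then show ?thesis using \<mu> by (simp add: W_def)
    next
      case False
      then have "r / 2 \<le> cmod (cyl_fst A z)" using z by (simp add: mem_cyl_iff[OF A])
      then have "(r / 2)\<^sup>2 \<le> (cmod (cyl_fst A z))\<^sup>2" using r by (intro power_mono) auto
      then have "\<mu> * (r / 2)\<^sup>2 \<le> \<mu> * (cmod (cyl_fst A z))\<^sup>2" using \<mu> by (intro mult_left_mono) auto
      then show ?thesis using False by (simp add: W_def x_def power_divide)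
    qed
    then show "ennreal (if z \<in> ?Q then ?c1 else ?c2) * indicator ?P z \<le> ennreal ((cmod (g 0))\<^sup>2 * W z) * indicator ?P z"
      unfolding g0 by (auto simp: indicator_def intro!: ennreal_leI)
  qed
  also have "\<dots> \<le> (\<integral>\<^sup>+ z. ennreal ((cmod (g z))\<^sup>2 * W z) * indicator ?P z \<partial>lborel)"
    by (rule holo_square_mean_ge[OF opP balanced_cyl[OF A] holg cW W0])
       (auto simp: W_def norm_mult)
  also have "\<dots> \<le> (\<integral>\<^sup>+ z. ennreal ((cmod (f (a + z)))\<^sup>2 * exp (- \<phi> (a + z))) * indicator ?P z \<partial>lborel)"
    using Wle by (intro nn_integral_mono) (auto simp: indicator_def intro!: ennreal_leI)
  also have "\<dots> \<le> emeasure lebesgue ?P * ennreal (exp (- \<phi> a))"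
    using fle unfolding nn_integral_ext_translate[OF opP c\<phi> holf] .
  also have "\<dots> = ennreal (V * exp (- \<phi> a))"
    using opP emeasure_cyl[OF A, of r s] by (simp add: V_def ennreal_mult)
  finally have "?c1 * m + ?c2 * (V - m) \<le> V * exp (- \<phi> a)"
    using V by (subst (asm) ennreal_le_iff) auto
  then have "exp (- \<phi> a) * (exp (- x / 16) * m + exp (3 * x / 16) * (V - m)) \<le> exp (- \<phi> a) * V"
    by (simp add: algebra_simps)
  then have "exp (- x / 16) * m + exp (3 * x / 16) * (V - m) \<le> V" by simp
  moreover have "exp (- x / 16) * m \<ge> (1 - x / 16) * m"
    using exp_ge_add_one_self[of "- x / 16"] by (intro mult_right_mono) (auto simp: m_def)
  moreover have "exp (3 * x / 16) * (V - m) \<ge> (1 + 3 * x / 16) * (V - m)"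
    using exp_ge_add_one_self[of "3 * x / 16"] m V by (intro mult_right_mono) (auto simp: m_def)
  ultimately have "(1 - x / 16) * m + (1 + 3 * x / 16) * (V - m) \<le> V" by linarith
  \<comment> \<open>Since \<open>2 * m \<le> V\<close>, the bracket is at least \<open>V\<close>,
    hence positive.\<close>
  then have "x * (3 * V - 4 * m) \<le> 0" by (simp add: algebra_simps)
  moreover have "x * (3 * V - 4 * m) > 0" using x m V by (intro mult_pos_pos) auto
  ultimately show False by simp
qed

lemma opt_ext_unique_imp_levi_nonpos:
  fixes a :: "complex^'n"
  assumes S: "open S" "smooth_on S \<phi>" and a: "a \<in> S" and A: "unitary A"
    and uniq: "\<And>r s f g. \<lbrakk>(a, r, s, A) \<in> Omega_td S; opt_ext \<phi> a (cyl A r s) f; opt_ext \<phi> a (cyl A r s) g\<rbrakk> \<Longrightarrow> f = g"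
  defines "M \<equiv> \<lambda>u v. dderiv2 \<phi> a u v + dderiv2 \<phi> a (\<i> *s u) (\<i> *s v)"
  shows "M (cyl_axis A) (cyl_axis A) \<le> 0"
proof (rule ccontr)
  define \<mu> where "\<mu> = M (cyl_axis A) (cyl_axis A) / 4"
  assume "\<not> ?thesis"
  then have \<mu>: "\<mu> > 0" by (simp add: \<mu>_def)
  obtain q \<delta> \<rho> where q: "holo_on UNIV q" "q 0 = 0" and \<delta>: "0 < \<delta>" and \<rho>: "0 < \<rho>"
    and inS: "\<And>r z. \<lbrakk>0 < r; r < \<rho>; z \<in> cyl A r (\<delta> * r)\<rbrakk> \<Longrightarrow> a + z \<in> S"
    and mod: "\<And>r z. \<lbrakk>0 < r; r < \<rho>; z \<in> cyl A r (\<delta> * r)\<rbrakk> \<Longrightarrow>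
      \<bar>\<phi> (a + z) - \<phi> a - Re (q z) - M (cyl_axis A) (cyl_axis A) / 4 * (cmod (cyl_fst A z))\<^sup>2\<bar> \<le> \<mu> / 16 * r\<^sup>2"
    using levi_local_model[OF S a A, of "\<mu> / 16"] \<mu> unfolding M_def by (metis divide_pos_pos zero_less_numeral)
  \<comment> \<open>The cap \<open>1 / sqrt \<mu>\<close> ensures \<open>x \<le> 1\<close>, so that
    the quadratic terms of the exponentials below are absorbed by the linear ones.\<close>
  define r where "r = min (\<rho> / 2) (1 / sqrt \<mu>)"
  have r: "0 < r" "r < \<rho>" using \<rho> \<mu> by (auto simp: r_def)
  define x where "x = \<mu> * r\<^sup>2"
  have x: "0 < x" "x \<le> 1"
  proof -
    have "r\<^sup>2 \<le> (1 / sqrt \<mu>)\<^sup>2" using r by (intro power_mono) (auto simp: r_def)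
    then show "x \<le> 1" using \<mu> by (simp add: x_def power_divide field_simps)
  qed (use \<mu> r in \<open>simp add: x_def\<close>)
  define s where "s = \<delta> * r"
  have s: "0 < s" using \<delta> r by (simp add: s_def)
  let ?P = "cyl A r s" and ?Q = "cyl A (r / 2) s"
  let ?T = "(\<lambda>z. a + z) ` ?P"
  define V where "V = measure lebesgue ?P"
  define m where "m = measure lebesgue ?Q"
  have V: "V > 0" unfolding V_def by (rule measure_cyl_pos[OF A r(1) s])
  have m: "2 * m \<le> V" unfolding V_def m_def by (rule measure_cyl_half[OF A r(1)])
  have m0: "m \<ge> 0" by (simp add: m_def)
  have TS: "?T \<subseteq> S" using inS[OF r] by (auto simp: s_def)
  then have td: "(a, r, s, A) \<in> Omega_td S" using a A r s by (simp add: Omega_td_def)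
  have opP: "open ?P" by (rule open_cyl[OF A])
  have c\<phi>: "continuous_on ?T \<phi>"
    using smooth_on_imp_continuous_on[OF S(2)] TS continuous_on_subset by blast
  \<comment> \<open>Relative to \<open>exp (- \<phi> a)\<close>, the weighted square of the
    unperturbed function is at most \<open>exp (x / 16)\<close> on the half cylinder and
    \<open>exp (- 3 * x / 16)\<close> on the rest. The worst case is an equal split of the volume,
    with mean \<open>\<theta>\<close>.\<close>
  define \<theta> where "\<theta> = (exp (x / 16) + exp (- 3 * x / 16)) / 2"
  have \<theta>: "0 < \<theta>" "\<theta> < 1"
  proof -
    define y where "y = 3 * x / 16"
    have y: "0 < y" using x by (simp add: y_def)
    have "exp (x / 16) \<le> 1 + x / 16 + (x / 16)\<^sup>2" using x by (intro exp_bound) auto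
    moreover have "exp (- y) \<le> 1 - y + y\<^sup>2"
    proof -
      \<comment> \<open>The product is \<open>1 + y ^ 3\<close>.\<close>
      have "1 \<le> (1 + y) * (1 - y + y\<^sup>2)" using y by (simp add: algebra_simps power2_eq_square)
      also have "\<dots> \<le> exp y * (1 - y + y\<^sup>2)"
      proof (rule mult_right_mono)
        have "1 - y + y\<^sup>2 = (y - 1 / 2)\<^sup>2 + 3 / 4" by (simp add: power2_eq_square algebra_simps)
        then show "0 \<le> 1 - y + y\<^sup>2" by simp
      qed (rule exp_ge_add_one_self)
      finally show ?thesis by (simp add: exp_minus field_simps)
    qed
    moreover have "x\<^sup>2 \<le> x" using x by (simp add: power2_eq_square mult_left_le)
    moreover have "(x / 16)\<^sup>2 = x\<^sup>2 / 256" "y\<^sup>2 = 9 * x\<^sup>2 / 256"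
      by (simp_all add: y_def power2_eq_square)
    ultimately have "exp (x / 16) + exp (- y) < 2" using x unfolding y_def by argo
    then show "\<theta> < 1" by (simp add: \<theta>_def y_def)
  qed (simp add: \<theta>_def add_pos_pos)
  \<comment> \<open>Perturbing by a coordinate that does not vanish on the axis keeps the value at
    the centre and changes the function elsewhere.\<close>
  obtain j where j: "cyl_axis A $ j \<noteq> 0"
  proof -
    have "cyl_axis A \<noteq> 0" using cyl_fst_axis[OF A] by (auto simp: linear_0 bounded_linear.linear[OF bounded_linear_cyl_fst])
    then show thesis using that by (auto simp: vec_eq_iff)
  qed
  obtain k where k: "k > 0" "\<And>z. z \<in> ?P \<Longrightarrow> norm z \<le> k"
    using bounded_cyl[OF A, of r s] bounded_pos by blast
  \<comment> \<open>The factor \<open>1 + t * z $ j\<close> has modulus at most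
    \<open>1 + \<epsilon> * k\<close> on the cylinder; \<open>\<epsilon>\<close> lets its square use
    up the slack \<open>1 / \<theta>\<close> exactly.\<close>
  define \<epsilon> where "\<epsilon> = (1 / sqrt \<theta> - 1) / k"
  have \<epsilon>: "\<epsilon> > 0" using \<theta> k by (simp add: \<epsilon>_def)
  have \<epsilon>\<theta>: "(1 + \<epsilon> * k)\<^sup>2 * \<theta> = 1"
    using \<theta> k by (simp add: \<epsilon>_def power_divide)
  define F where "F t y = (if y \<in> ?T then exp (q (y - a) * (1 / 2)) * (1 + of_real t * ((y - a) $ j)) else 0)" for t y
  have opt: "opt_ext \<phi> a ?P (F t)" if t: "0 \<le> t" "t \<le> \<epsilon>" for t
  proof -
    have "holo_on ?T (\<lambda>y. exp (q (y - a) * (1 / 2)) * (1 + of_real t * ((y - a) $ j)))"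
      by (intro holo_on_mult holo_on_exp holo_on_add holo_on_const holo_on_UNIV_translate[OF q(1)]
          holo_on_UNIV_translate[OF holo_on_component])
    then have hol: "holo_on ?T (F t)" by (rule holo_on_cong[rotated]) (simp add: F_def)
    have aT: "a \<in> ?T" using zero_in_cyl[OF A r(1) s] by (intro image_eqI[of _ _ 0]) auto
    then have Fa: "F t a = 1" by (simp add: F_def q)
    let ?c1 = "exp (- \<phi> a) * (1 + \<epsilon> * k)\<^sup>2 * exp (x / 16)" and ?c2 = "exp (- \<phi> a) * (1 + \<epsilon> * k)\<^sup>2 * exp (- 3 * x / 16)"
    have bound: "(cmod (F t (a + z)))\<^sup>2 * exp (- \<phi> (a + z)) \<le> (if z \<in> ?Q then ?c1 else ?c2)" if z: "z \<in> ?P" for z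
    proof -
      have "cmod (1 + of_real t * z $ j) \<le> 1 + t * cmod (z $ j)"
        using norm_triangle_ineq[of 1 "of_real t * z $ j"] t by (simp add: norm_mult)
      also have "\<dots> \<le> 1 + \<epsilon> * k"
        using t k(2)[OF z] Finite_Cartesian_Product.norm_nth_le[of z j] by (intro add_left_mono mult_mono) auto
      finally have 1: "(cmod (1 + of_real t * z $ j))\<^sup>2 \<le> (1 + \<epsilon> * k)\<^sup>2" by (intro power_mono) auto
      have F: "(cmod (F t (a + z)))\<^sup>2 = exp (Re (q z)) * (cmod (1 + of_real t * z $ j))\<^sup>2"
        using z by (simp add: F_def norm_mult power_mult_distrib flip: exp_double)
      have "\<bar>\<phi> (a + z) - \<phi> a - Re (q z) - \<mu> * (cmod (cyl_fst A z))\<^sup>2\<bar> \<le> x / 16"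
        using mod[OF r, of z] z by (simp add: \<mu>_def[symmetric] x_def s_def)
      then have E: "Re (q z) - \<phi> (a + z) \<le> - \<phi> a - \<mu> * (cmod (cyl_fst A z))\<^sup>2 + x / 16" by linarith
      have "(cmod (F t (a + z)))\<^sup>2 * exp (- \<phi> (a + z)) = (cmod (1 + of_real t * z $ j))\<^sup>2 * exp (Re (q z) - \<phi> (a + z))"
        unfolding F by (simp add: exp_diff exp_minus divide_inverse)
      also have "\<dots> \<le> (1 + \<epsilon> * k)\<^sup>2 * exp (- \<phi> a - \<mu> * (cmod (cyl_fst A z))\<^sup>2 + x / 16)"
        using 1 E by (intro mult_mono) auto
      also have "\<dots> \<le> (if z \<in> ?Q then ?c1 else ?c2)"
      proof (cases "z \<in> ?Q")
        case True
        have "(1 + \<epsilon> * k)\<^sup>2 * exp (- \<phi> a - \<mu> * (cmod (cyl_fst A z))\<^sup>2 + x / 16) \<le> (1 + \<epsilon> * k)\<^sup>2 * exp (- \<phi> a + x / 16)"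
          using \<mu> by (intro mult_left_mono) auto
        then show ?thesis unfolding exp_add[of "- \<phi> a"] using True by (simp add: mult_ac)
      next
        case False
        then have "r / 2 \<le> cmod (cyl_fst A z)" using z by (simp add: mem_cyl_iff[OF A])
        then have "(r / 2)\<^sup>2 \<le> (cmod (cyl_fst A z))\<^sup>2" using r by (intro power_mono) auto
        then have "\<mu> * (r / 2)\<^sup>2 \<le> \<mu> * (cmod (cyl_fst A z))\<^sup>2" using \<mu> by (intro mult_left_mono) auto
        then have "(1 + \<epsilon> * k)\<^sup>2 * exp (- \<phi> a - \<mu> * (cmod (cyl_fst A z))\<^sup>2 + x / 16) \<le> (1 + \<epsilon> * k)\<^sup>2 * exp (- \<phi> a + - 3 * x / 16)"
          by (intro mult_left_mono) (auto simp: x_def power_divide)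
        then show ?thesis unfolding exp_add[of "- \<phi> a"] using False by (simp add: mult_ac)
      qed
      finally show ?thesis .
    qed
    have "(\<integral>\<^sup>+ y \<in> ?T. ennreal ((cmod (F t y))\<^sup>2 * exp (- \<phi> y)) \<partial>lebesgue)
        = (\<integral>\<^sup>+ z. ennreal ((cmod (F t (a + z)))\<^sup>2 * exp (- \<phi> (a + z))) * indicator ?P z \<partial>lborel)"
      by (rule nn_integral_ext_translate[OF opP c\<phi> hol])
    also have "\<dots> \<le> (\<integral>\<^sup>+ z. ennreal (if z \<in> ?Q then ?c1 else ?c2) * indicator ?P z \<partial>lborel)"
    proof (intro nn_integral_mono)
      show "ennreal ((cmod (F t (a + z)))\<^sup>2 * exp (- \<phi> (a + z))) * indicator ?P z
          \<le> ennreal (if z \<in> ?Q then ?c1 else ?c2) * indicator ?P z" for z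
        using ennreal_leI[OF bound[of z]] by (cases "z \<in> ?P") simp_all
    qed
    also have "\<dots> = ennreal (?c1 * m + ?c2 * (V - m))"
      unfolding V_def m_def by (rule nn_integral_cyl_two_levels[OF A r(1)]) auto
    also have "\<dots> \<le> ennreal (V * exp (- \<phi> a))"
    proof (rule ennreal_leI)
      have "exp (- 3 * x / 16) \<le> exp (x / 16)" using x by simp
      then have "(exp (x / 16) - exp (- 3 * x / 16)) * m \<le> (exp (x / 16) - exp (- 3 * x / 16)) * (V / 2)"
        using m by (intro mult_left_mono) auto
      then have "exp (x / 16) * m + exp (- 3 * x / 16) * (V - m) \<le> \<theta> * V"
        by (simp add: \<theta>_def algebra_simps add_divide_distrib)
      then have "exp (- \<phi> a) * (1 + \<epsilon> * k)\<^sup>2 * (exp (x / 16) * m + exp (- 3 * x / 16) * (V - m)) \<le> exp (- \<phi> a) * (1 + \<epsilon> * k)\<^sup>2 * (\<theta> * V)"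
        by (intro mult_left_mono) auto
      also have "\<dots> = exp (- \<phi> a) * ((1 + \<epsilon> * k)\<^sup>2 * \<theta>) * V" by simp
      finally show "?c1 * m + ?c2 * (V - m) \<le> V * exp (- \<phi> a)" unfolding \<epsilon>\<theta> by (simp add: algebra_simps)
    qed
    also have "\<dots> = emeasure lebesgue ?P * ennreal (exp (- \<phi> a))"
      using opP emeasure_cyl[OF A, of r s] by (simp add: V_def ennreal_mult)
    finally show ?thesis using hol Fa by (auto simp: opt_ext_def F_def)
  qed
  have eq: "F 0 = F \<epsilon>" by (rule uniq[OF td opt opt]) (use \<epsilon> in auto)
  \<comment> \<open>Any nonzero point of the axis inside the cylinder separates \<open>F 0\<close>
    from \<open>F \<epsilon>\<close>.\<close>
  define z where "z = complex_of_real (r / 2) *s cyl_axis A"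
  have z: "z \<in> ?P" using r s by (simp add: mem_cyl_iff[OF A] z_def cyl_fst_axis[OF A] cyl_snd_axis[OF A] norm_mult)
  have "F 0 (a + z) = F \<epsilon> (a + z)" by (simp add: eq)
  then have "of_real \<epsilon> * z $ j = 0" using z by (simp add: F_def)
  then show False using \<epsilon> r j by (simp add: z_def)
qed

section \<open>Equivalence of pluriharmonicity and unique optimal extension\<close>

theorem theoremA1:
  fixes \<Omega> :: "(complex^'n) set" and \<phi> :: "complex^'n \<Rightarrow> real"
  assumes "open \<Omega>" and "connected \<Omega>" and "\<Omega> \<noteq> {}"
    and "smooth_on \<Omega> \<phi>"
  shows "pluriharmonic_on \<Omega> \<phi> \<longleftrightarrow>
    (\<forall>(a, r, s, A) \<in> Omega_td \<Omega>.
       \<exists>!f. holo_on ((\<lambda>z. a + z) ` cyl A r s) f \<and>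
            (\<forall>x. x \<notin> (\<lambda>z. a + z) ` cyl A r s \<longrightarrow> f x = 0) \<and>
            f a = 1 \<and>
            (\<integral>\<^sup>+ x \<in> (\<lambda>z. a + z) ` cyl A r s. ennreal ((cmod (f x))\<^sup>2 * exp (- \<phi> x)) \<partial>lebesgue)
              \<le> emeasure lebesgue (cyl A r s) * ennreal (exp (- \<phi> a)))"
  unfolding opt_ext_def[symmetric]
proof
  note S = assms(1,4)
  assume ph: "pluriharmonic_on \<Omega> \<phi>"
  show "\<forall>(a, r, s, A) \<in> Omega_td \<Omega>. \<exists>!f. opt_ext \<phi> a (cyl A r s) f"
  proof clarify
    fix a :: "complex^'n" and r s :: real and A :: "complex^'n^'n"
    assume "(a, r, s, A) \<in> Omega_td \<Omega>"
    then have a: "a \<in> \<Omega>" and r: "0 < r" and s: "0 < s" and A: "unitary A" and sub: "(\<lambda>z. a + z) ` cyl A r s \<subseteq> \<Omega>"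
      by (auto simp: Omega_td_def)
    let ?P = "cyl A r s"
    let ?T = "(\<lambda>z. a + z) ` ?P"
    have opP: "open ?P" by (rule open_cyl[OF A])
    have opT: "open ?T" using opP by (rule open_translation)
    have conT: "convex ?T" using convex_cyl[OF A] by (simp add: convex_translation)
    have aT: "a \<in> ?T" using zero_in_cyl[OF A r s] by (intro image_eqI[of _ _ 0]) auto
    have c\<phi>: "continuous_on ?T \<phi>"
      using smooth_on_imp_continuous_on[OF S(2)] sub continuous_on_subset by blast
    have fin: "emeasure lborel ?P < \<infinity>" by (simp add: emeasure_cyl[OF A])
    have leb: "emeasure lebesgue ?P = emeasure lborel ?P" using opP by simp
    obtain h where h: "holo_on ?T h" "\<And>x. x \<in> ?T \<Longrightarrow> Re (h x) = \<phi> x"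
      using pluriharmonic_on_imp_Re_holo[OF S ph conT sub opT] by blast
    \<comment> \<open>The half compensates the square: \<open>(cmod (exp (E x)))\<^sup>2\<close> is
      \<open>exp (\<phi> x - \<phi> a)\<close>, so the weighted integrand is constant and the bound
      is attained with equality.\<close>
    define E where "E x = (h x + (- h a)) * (1 / 2)" for x
    have holE: "holo_on ?T E"
      unfolding E_def[abs_def] by (intro holo_on_mult holo_on_add holo_on_const h)
    have Ea: "E a = 0" by (simp add: E_def)
    have ReE: "Re (E x) = (\<phi> x - \<phi> a) / 2" if "x \<in> ?T" for x
      using h(2)[OF that] h(2)[OF aT] by (simp add: E_def)
    define f0 where "f0 x = (if x \<in> ?T then exp (E x) else 0)" for x
    have hol0: "holo_on ?T f0"
      by (rule holo_on_cong[OF _ holo_on_exp[OF holE]]) (simp add: f0_def)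
    have "opt_ext \<phi> a ?P f0"
    proof -
      have "(\<integral>\<^sup>+ x \<in> ?T. ennreal ((cmod (f0 x))\<^sup>2 * exp (- \<phi> x)) \<partial>lebesgue)
        = (\<integral>\<^sup>+ z. ennreal ((cmod (f0 (a + z)))\<^sup>2 * exp (- \<phi> (a + z))) * indicator ?P z \<partial>lborel)"
        by (rule nn_integral_ext_translate[OF opP c\<phi> hol0])
      also have "\<dots> = (\<integral>\<^sup>+ z. ennreal (exp (- \<phi> a)) * indicator ?P z \<partial>lborel)"
      proof (intro nn_integral_cong)
        fix z
        have "(cmod (f0 (a + z)))\<^sup>2 * exp (- \<phi> (a + z)) = exp (- \<phi> a)" if "z \<in> ?P"
          using that ReE[of "a + z"] by (simp add: f0_def flip: exp_double exp_add)
        then show "ennreal ((cmod (f0 (a + z)))\<^sup>2 * exp (- \<phi> (a + z))) * indicator ?P z = ennreal (exp (- \<phi> a)) * indicator ?P z"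
          by (auto simp: indicator_def)
      qed
      also have "\<dots> = emeasure lebesgue ?P * ennreal (exp (- \<phi> a))"
        using opP by (simp add: nn_integral_cmult_indicator mult.commute)
      finally show ?thesis using hol0 aT Ea by (auto simp: opt_ext_def f0_def)
    qed
    moreover have "f = f0" if f: "opt_ext \<phi> a ?P f" for f
    proof
      have holf: "holo_on ?T f" and f1: "f a = 1" and fz: "\<And>x. x \<notin> ?T \<Longrightarrow> f x = 0"
        and fle: "(\<integral>\<^sup>+ x \<in> ?T. ennreal ((cmod (f x))\<^sup>2 * exp (- \<phi> x)) \<partial>lebesgue) \<le> emeasure lebesgue ?P * ennreal (exp (- \<phi> a))"
        using f by (auto simp: opt_ext_def)
      \<comment> \<open>Division by the extremal function turns the weighted bound for
        \<open>f\<close> into the unweighted one for \<open>g\<close>, with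
        \<open>g 0 = 1\<close>.\<close>
      define g where "g z = f (a + z) * exp (E (a + z) * (- 1))" for z
      have holg: "holo_on ?P g"
        using holo_on_translate[OF holo_on_mult[OF holf holo_on_exp[OF holo_on_mult[OF holE holo_on_const[of _ "- 1"]]]]]
        by (simp add: g_def[abs_def])
      have gm [measurable]: "(\<lambda>z. ennreal ((cmod (g z))\<^sup>2) * indicator ?P z) \<in> borel_measurable borel"
        by (intro borel_measurable_indicator_ennreal continuous_intros holo_on_imp_continuous_on[OF holg])
           (use opP in auto)
      have "ennreal (exp (- \<phi> a)) * (\<integral>\<^sup>+ z. ennreal ((cmod (g z))\<^sup>2) * indicator ?P z \<partial>lborel)
          = (\<integral>\<^sup>+ z. ennreal (exp (- \<phi> a)) * (ennreal ((cmod (g z))\<^sup>2) * indicator ?P z) \<partial>lborel)"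
        by (rule nn_integral_cmult[symmetric]) simp
      also have "\<dots> = (\<integral>\<^sup>+ z. ennreal ((cmod (f (a + z)))\<^sup>2 * exp (- \<phi> (a + z))) * indicator ?P z \<partial>lborel)"
      proof (intro nn_integral_cong)
        fix z
        have "exp (- \<phi> a) * (cmod (g z))\<^sup>2 = (cmod (f (a + z)))\<^sup>2 * exp (- \<phi> (a + z))" if "z \<in> ?P"
        proof -
          have "(cmod (g z))\<^sup>2 = (cmod (f (a + z)))\<^sup>2 * exp (\<phi> a - \<phi> (a + z))"
            using that ReE[of "a + z"] by (simp add: g_def norm_mult power_mult_distrib flip: exp_double)
          then show ?thesis by (simp add: exp_diff exp_minus field_simps)
        qed
        then show "ennreal (exp (- \<phi> a)) * (ennreal ((cmod (g z))\<^sup>2) * indicator ?P z)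
            = ennreal ((cmod (f (a + z)))\<^sup>2 * exp (- \<phi> (a + z))) * indicator ?P z"
          by (auto simp: indicator_def simp flip: ennreal_mult)
      qed
      also have "\<dots> \<le> ennreal (exp (- \<phi> a)) * emeasure lborel ?P"
        using fle unfolding nn_integral_ext_translate[OF opP c\<phi> holf] leb by (simp add: mult.commute)
      finally have "(\<integral>\<^sup>+ z. ennreal ((cmod (g z))\<^sup>2) * indicator ?P z \<partial>lborel) \<le> emeasure lborel ?P"
        by (subst (asm) ennreal_mult_le_mult_iff) auto
      then have g1: "g z = 1" if "z \<in> ?P" for z
        using holo_square_mean_le_imp_eq_1[OF opP balanced_cyl[OF A] fin holg _ _ that] f1 Ea
        by (simp add: g_def)
      \<comment> \<open>Uniqueness is meant for total functions; the prescribed value 0 off the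
        cylinder settles the points there.\<close>
      fix x show "f x = f0 x"
      proof (cases "x \<in> ?T")
        case True
        then obtain z where z: "x = a + z" "z \<in> ?P" by blast
        then have "f x * exp (- E x) = 1" using g1[of z] by (simp add: g_def)
        then show ?thesis using True by (simp add: f0_def exp_minus field_simps)
      qed (simp add: fz f0_def)
    qed
    ultimately show "\<exists>!f. opt_ext \<phi> a ?P f" by blast
  qed
next
  note S = assms(1,4)
  assume R: "\<forall>(a, r, s, A) \<in> Omega_td \<Omega>. \<exists>!f. opt_ext \<phi> a (cyl A r s) f"
  have R': "\<exists>!f. opt_ext \<phi> a (cyl A r s) f" if "(a, r, s, A) \<in> Omega_td \<Omega>" for a r s and A :: "complex^'n^'n"
    using R that by blast
  show "pluriharmonic_on \<Omega> \<phi>"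
    unfolding pluriharmonic_on_def
  proof
    fix a assume a: "a \<in> \<Omega>"
    define M where "M u v = dderiv2 \<phi> a u v + dderiv2 \<phi> a (\<i> *s u) (\<i> *s v)" for u v
    note bH = bilinear_dderiv2[OF S a]
    have bM: "bilinear M" unfolding M_def[abs_def] by (rule bilinear_levi[OF bH])
    have axis: "M (cyl_axis A) (cyl_axis A) = 0" if A: "unitary A" for A
    proof (rule antisym)
      show "M (cyl_axis A) (cyl_axis A) \<ge> 0"
        unfolding M_def by (rule opt_ext_imp_levi_nonneg[OF S a A]) (use R' in blast)
      show "M (cyl_axis A) (cyl_axis A) \<le> 0"
        unfolding M_def by (rule opt_ext_unique_imp_levi_nonpos[OF S a A]) (use R' in blast)
    qed
    have diag: "M u u = 0" for u
    proof (cases "u = 0")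
      case True then show ?thesis by (simp add: bilinear_lzero[OF bM])
    next
      case False
      define p where "p = u $ first_idx"
      \<comment> \<open>Scales \<open>u\<close> to norm 1 and makes its first entry real, as
        \<open>ex_unitary_axis\<close> requires; a zero entry needs no phase. By
        \<open>levi_rotate\<close> this changes the Levi form only by a positive factor.\<close>
      define c where "c = (if p = 0 then 1 else cnj p / of_real (cmod p)) / of_real (norm u)"
      have c: "cmod c = 1 / norm u" "c \<noteq> 0" using False by (auto simp: c_def norm_divide)
      have "c * p = of_real (cmod p / norm u)"
        by (simp add: c_def complex_norm_square[symmetric] power2_eq_square mult.commute)
      then have "Im ((c *s u) $ first_idx) = 0" by (simp add: p_def)
      moreover have "norm (c *s u) = 1" using c False by (simp add: norm_vector_smult)
      ultimately obtain A where "unitary A" "cyl_axis A = c *s u"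
        using ex_unitary_axis by blast
      then have "M (c *s u) (c *s u) = 0" using axis by metis
      moreover have "M (c *s u) (c *s u) = (cmod c)\<^sup>2 * M u u"
        unfolding M_def by (rule levi_rotate[OF bH])
      ultimately show ?thesis using c False by simp
    qed
    \<comment> \<open>Polarization: a symmetric bilinear form vanishing on the diagonal is
      zero.\<close>
    have "M u v = 0" for u v
    proof -
      have "M u v = M v u" by (simp add: M_def dderiv2_commute[OF S a, of u] dderiv2_commute[OF S a, of "\<i> *s u"])
      moreover have "M (u + v) (u + v) = M u u + M u v + M v u + M v v"
        by (simp add: bilinear_ladd[OF bM] bilinear_radd[OF bM])
      ultimately show ?thesis using diag by simp
    qed
    then show "\<forall>j k. ddbar \<phi> a j k = 0"
      unfolding ddbar_eq_0_iff[OF S a] by (simp add: M_def)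
  qed
qed

end
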